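(* Let $\tau>0$ be fixed, let $Z=\{\tilde z\in\tilde\Omega : F_\tau(\tilde z)=\mathbf 0\}$, and let $\tilde z^*=(v^*,\lambda^*,u^* )\in Z$, with $F_\tau$, $\tilde\Omega$ and the inner loop as defined in the context. Suppose that the full row rank condition (R) of the context holds at $\tilde z^*$ for every admissible choice of partitions $(\mathcal A_g^{3,1},\mathcal A_g^{3,2})$, $(\mathcal A_G^{3,1},\mathcal A_G^{3,2})$, $(\mathcal A_H^{3,1},\mathcal A_H^{3,2})$, $(\mathcal A_{GH}^{3,1},\mathcal A_{GH}^{3,2})$ (that is, for every selection function of $F_\tau$ active at $\tilde z^*$). Then there exists $r>0$ such that any infinite sequence $\{\tilde z^j\}$ generated by the inner loop with starting point $\tilde z^0\in\mathcal B_r(\tilde z^* )\cap\tilde\Omega$ converges to some $\hat z\in Z$, and the rate of convergence is Q-quadratic. Here $\mathcal B_r(\tilde z^* )=\{\tilde z\in\mathbb{R}^{\overline q} : \|\tilde z-\tilde z^*\|\le r\}$.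
   Context: **Problem (P).** Let $K,m_1,m_2,n$ be positive integers, $[N]:=\{1,\dots,N\}$, and let $\mathbf 1$ denote an all-ones vector. For each fold $t=1,\dots,K$ of a $K$-fold cross-validation there are $m_2$ training points and $m_1$ validation points $(x,y)$ with $x\in\mathbb{R}^n$ and label $y\in\{\pm1\}$. Let $B^t\in\mathbb{R}^{m_2\times n}$ be the matrix whose rows are $y\,x^\top$ over the training points of fold $t$, and $A^t\in\mathbb{R}^{m_1\times n}$ the matrix whose rows are $y\,x^\top$ over the validation points of fold $t$. Let $B=\mathrm{diag}(B^1,\dots,B^K)$ and $A=\mathrm{diag}(A^1,\dots,A^K)$ (block diagonal), and let $E_K^n\in\mathbb{R}^{Kn\times n}$ be $K$ copies of $I_n$ stacked vertically. Let $C_{lb},C_{ub}\in\mathbb{R}_+$, $\overline w_{lb},\overline w_{ub}\in\mathbb{R}^n_+$ be given bounds. Put $\overline n=1+n$, $\overline m=2K(m_1+m_2+n)$. The variable is $v=[C,\overline w^\top,\zeta^\top,z^\top,\alpha^\top,\xi^\top,\beta^\top,\gamma^\top]^\top\in\mathbb{R}^{\overline n+\overline m}$ with $C\in\mathbb{R}$, $\overline w\in\mathbb{R}^n$, $\zeta,z\in\mathbb{R}^{Km_1}$, $\alpha,\xi\in\mathbb{R}^{Km_2}$, $\beta,\gamma\in\mathbb{R}^{Kn}$. Problem (P) is $$\min_v f(v)\quad\text{s.t.}\quad g(v)\ge\mathbf 0,\quad \mathbf 0\le H(v)\perp G(v)\ge\mathbf 0,$$ with $f(v)=\frac1{Km_1}\mathbf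 1^\top\zeta$, $g(v)=(C_{ub}-C,\ C-C_{lb},\ \overline w_{ub}-\overline w,\ \overline w-\overline w_{lb})\in\mathbb{R}^{2\overline n}$, $H(v)=(\zeta,z,\alpha,\xi,\beta,\gamma)\in\mathbb{R}^{\overline m}$, and $$G(v)=\begin{pmatrix}AB^\top\alpha+A\beta-A\gamma+z\\ \mathbf 1-\zeta\\ BB^\top\alpha+B\beta-B\gamma-\mathbf 1+\xi\\ \mathbf 1C-\alpha\\ B^\top\alpha+\beta-\gamma+E_K^n\overline w\\ -B^\top\alpha-\beta+\gamma+E_K^n\overline w\end{pmatrix}\in\mathbb{R}^{\overline m}.$$ **Relaxed KKT system.** For $\tau>0$, the relaxed problem (NLP-$\tau$) is $\min f(v)$ s.t. $g(v)\ge\mathbf 0$, $G(v)\ge\mathbf 0$, $H(v)\ge\mathbf 0$, $G_i(v)H_i(v)\le\tau$ ($i\in[\overline m]$). With $\lambda=(\lambda^g,\lambda^G,\lambda^H,\lambda^{GH})\in\mathbb{R}^{2\overline n}\times\mathbb{R}^{\overline m}\times\mathbb{R}^{\overline m}\times\mathbb{R}^{\overline m}$ its Lagrangian is $$L(v,\lambda)=f(v)-\sum_i\lambda^g_ig_i(v)-\sum_i\lambda^G_iG_i(v)-\sum_i\lambda^H_iH_i(v)+\sum_i\lambda^{GH}_i[G_i(v)H_i(v)-\tau].$$ With slack $u\in\mathbb{R}^{\overline m}$, $\tilde z=(v,\lambda,u)\in\mathbb{R}^{\overline q}$, $\overline q=3\overline n+5\overline m$, let $$F_\tau(\tilde z)=\begin{pmatrix}\nabla_vL(v,\lambda)\\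 u+G(v)H(v)-\tau\mathbf 1\\ \min\{\lambda^g,g(v)\}\\ \min\{\lambda^G,G(v)\}\\ \min\{\lambda^H,H(v)\}\\ \min\{\lambda^{GH},u\}\end{pmatrix}\in\mathbb{R}^{\overline q},$$ $$\tilde\Omega=\{\tilde z:\lambda\ge\mathbf 0,\ u\ge\mathbf 0,\ g(v)\ge\mathbf 0,\ G(v)\ge\mathbf 0,\ H(v)\ge\mathbf 0\},$$ where $G(v)H(v)$ is the componentwise product and $\min$ is componentwise. $F_\tau$ is piecewise quadratic: its selection functions are the $2^{2\overline n+3\overline m}$ quadratic maps obtained by replacing each scalar minimum by one of its two arguments; a selection function is active at $\tilde z$ if it coincides with $F_\tau$ at $\tilde z$. **Inner loop (LP-Newton method with line search, $\tau$ fixed).** Parameters $\sigma_1,\theta\in(0,1)$. Given $\tilde z^j\in\tilde\Omega$: if $\|F_\tau(\tilde z^j)\|_\infty=0$, stop. Otherwise let $\mathcal J(\tilde z^j)\in\partial F_\tau(\tilde z^j)$ (Clarke's generalized Jacobian), selected as the Jacobian of a selection function active at $\tilde z^j$, and let $(\eta^j,d^j)\in\mathbb{R}\times\mathbb{R}^{\overline q}$ be a solution of $$\min_{\eta,d}\ \eta\quad\text{s.t.}\quad \|F_\tau(\tilde z^j)+\mathcal J(\tilde z^j)d\|_\infty\le\eta\|F_\tau(\tilde z^j)\|_\infty^2,\quad \|d\|_\infty\le\eta\|F_\tau(\tilde z^j)\|_\infty,\quad \tilde z^j+d\in\tilde\Omega.$$ Put $\Delta_j=-\|F_\tau(\tilde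 z^j)\|_\infty(1-\eta^j\|F_\tau(\tilde z^j)\|_\infty)$; if $\Delta_j=0$, stop. Otherwise let $m\ge0$ be the minimal integer with $\|F_\tau(\tilde z^j+\theta^md^j)\|_\infty\le\|F_\tau(\tilde z^j)\|_\infty+\sigma_1\theta^m\Delta_j$, and set $\tilde z^{j+1}=\tilde z^j+\theta^md^j$. **Index sets and condition (R).** At $\tilde z^*$ let $\mathcal A_g^1,\mathcal A_g^2,\mathcal A_g^3$ be the sets of $i\in[2\overline n]$ with $(\lambda^g)^*_i<g_i(v^* )$, $(\lambda^g)^*_i>g_i(v^* )$, $(\lambda^g)^*_i=g_i(v^* )$ respectively. Define $\mathcal A_G^{1,2,3}$ analogously as subsets of $[\overline m]$ by comparing $(\lambda^G)^*_i$ with $G_i(v^* )$, $\mathcal A_H^{1,2,3}$ by comparing $(\lambda^H)^*_i$ with $H_i(v^* )$, and $\mathcal A_{GH}^{1,2,3}$ by comparing $(\lambda^{GH})^*_i$ with $u^*_i$ (superscript 1: $<$; 2: $>$; 3: $=$). An admissible choice of partitions splits each $\mathcal A_\bullet^3$ ($\bullet\in\{g,G,H,GH\}$) into disjoint $\mathcal A_\bullet^{3,1}\cup\mathcal A_\bullet^{3,2}$; it corresponds to the selection function in which the minimum is replaced by the multiplier for indices in $\mathcal A_\bullet^1\cup\mathcal A_\bullet^{3,1}$ and by the other argument for indices in $\mathcal A_\bullet^2\cup\mathcal A_\bullet^{3,2}$. Write $P_\bullet=\mathcal A_\bullet^2\cup\mathcal A_\bullet^{3,2}$ and $N_{GH}=\mathcal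 A_{GH}^1\cup\mathcal A_{GH}^{3,1}$. Gradients are columns: $\nabla g(v)=[\nabla g_1(v),\dots]$ and similarly for $G,H$; $S$ is the matrix with columns $G_i(v)\nabla H_i(v)+H_i(v)\nabla G_i(v)$, $i\in[\overline m]$. $M_{(\cdot,J)}$ and $M_{(J,\cdot)}$ denote column and row submatrices. Condition (R): the following matrix, evaluated at $(v,\lambda)=(v^*,\lambda^* )$, has full row rank: $$\begin{pmatrix} \nabla^2_{vv}L(v,\lambda)&-\nabla g(v)_{(\cdot,P_g)}&-\nabla G(v)_{(\cdot,P_G)}&-\nabla H(v)_{(\cdot,P_H)}&S_{(\cdot,P_{GH})}&\mathbf 0\\ S^\top&\mathbf 0&\mathbf 0&\mathbf 0&\mathbf 0&I_{(\cdot,N_{GH})}\\ \nabla g(v)^\top_{(P_g,\cdot)}&\mathbf 0&\mathbf 0&\mathbf 0&\mathbf 0&\mathbf 0\\ \nabla G(v)^\top_{(P_G,\cdot)}&\mathbf 0&\mathbf 0&\mathbf 0&\mathbf 0&\mathbf 0\\ \nabla H(v)^\top_{(P_H,\cdot)}&\mathbf 0&\mathbf 0&\mathbf 0&\mathbf 0&\mathbf 0 \end{pmatrix}.$$ *)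

theory Defs
  imports "HOL-Analysis.Analysis"
begin

text \<open>
  A vector with several blocks is indexed by the sum of the index types of its blocks.
  On matrices, \<^term>\<open>vapp\<close> stacks rows and \<^term>\<open>happ\<close> juxtaposes columns.
\<close>

definition vapp :: "'a ^ 'm \<Rightarrow> 'a ^ 'n \<Rightarrow> 'a ^ ('m + 'n)"  (infixr "\<frown>" 60) where
  "x \<frown> y = (\<chi> i. case i of Inl a \<Rightarrow> x $ a | Inr b \<Rightarrow> y $ b)"

definition happ :: "'a ^ 'm ^ 'r \<Rightarrow> 'a ^ 'n ^ 'r \<Rightarrow> 'a ^ ('m + 'n) ^ 'r"  (infixr "|||" 62) where
  "M ||| N = (\<chi> i. M $ i \<frown> N $ i)"

definition fstblock :: "'a ^ ('m::finite + 'n::finite) \<Rightarrow> 'a ^ 'm" where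
  "fstblock x = (\<chi> i. x $ Inl i)"

definition sndblock :: "'a ^ ('m::finite + 'n::finite) \<Rightarrow> 'a ^ 'n" where
  "sndblock x = (\<chi> i. x $ Inr i)"

definition block_diag :: "('k::finite \<Rightarrow> real ^ 'n ^ 'm) \<Rightarrow> real ^ ('k \<times> 'n) ^ ('k \<times> 'm)" where
  "block_diag M = (\<chi> p q. if fst p = fst q then M (fst p) $ snd p $ snd q else 0)"

definition stacked_id :: "real ^ 'n ^ ('k::finite \<times> 'n)" where
  "stacked_id = (\<chi> p j. if snd p = j then 1 else 0)"

text \<open>
  The order \<open>\<le>\<close> on vectors is componentwise, but the overloaded \<^term>\<open>min\<close> is not.
\<close>

definition vmin :: "real ^ 'i \<Rightarrow> real ^ 'i \<Rightarrow> real ^ 'i" where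
  "vmin a b = (\<chi> i. min (a $ i) (b $ i))"

text \<open>The submatrix with row set \<open>R\<close> and column set \<open>C\<close> has the same rank as the matrix in which
  all other entries are replaced by zero.\<close>

definition submatrix_rank :: "'r set \<Rightarrow> 'c set \<Rightarrow> real ^ 'c ^ 'r \<Rightarrow> nat" where
  "submatrix_rank R C M = rank (\<chi> i j. if i \<in> R \<and> j \<in> C then M $ i $ j else 0)"

definition submatrix_full_row_rank :: "'r set \<Rightarrow> 'c set \<Rightarrow> real ^ 'c ^ 'r \<Rightarrow> bool" where
  "submatrix_full_row_rank R C M \<longleftrightarrow> submatrix_rank R C M = card R"

definition gradient :: "('a::real_inner \<Rightarrow> real) \<Rightarrow> 'a \<Rightarrow> 'a" where
  "gradient f x = (THE D. GDERIV f x :> D)"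

text \<open>The matrix whose columns are the gradients of the component functions.\<close>

definition grad_columns :: "(real ^ 'a \<Rightarrow> real ^ 'b) \<Rightarrow> real ^ 'a \<Rightarrow> real ^ 'b ^ 'a" where
  "grad_columns f x = transpose (jacobian f (at x))"

definition clarke_jacobian :: "(real ^ 'a \<Rightarrow> real ^ 'b) \<Rightarrow> real ^ 'a \<Rightarrow> (real ^ 'a ^ 'b) set" where
  "clarke_jacobian f x = convex hull
     {M. \<exists>X. (\<forall>k::nat. f differentiable (at (X k))) \<and> X \<longlonglongrightarrow> x \<and>
             (\<lambda>k. jacobian f (at (X k))) \<longlonglongrightarrow> M}"

definition Q_quadratic_rate :: "(nat \<Rightarrow> 'a::real_normed_vector) \<Rightarrow> 'a \<Rightarrow> bool" where
  "Q_quadratic_rate X l \<longleftrightarrow>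
     (\<exists>c. \<forall>\<^sub>F j in sequentially. norm (X (Suc j) - l) \<le> c * (norm (X j - l))\<^sup>2)"

text \<open>
  Folds, validation points, training points and features are indexed by the finite types
  \<open>'k\<close>, \<open>'m1\<close>, \<open>'m2\<close> and \<open>'n\<close>.
\<close>

record ('k, 'm1, 'm2, 'n::finite) cv_problem =
  x_train :: "'k \<Rightarrow> 'm2 \<Rightarrow> real ^ 'n"
  y_train :: "'k \<Rightarrow> 'm2 \<Rightarrow> real"
  x_val :: "'k \<Rightarrow> 'm1 \<Rightarrow> real ^ 'n"
  y_val :: "'k \<Rightarrow> 'm1 \<Rightarrow> real"
  C_lb :: real
  C_ub :: real
  w_lb :: "real ^ 'n"
  w_ub :: "real ^ 'n"

definition valid_problem :: "('k::finite, 'm1::finite, 'm2::finite, 'n::finite) cv_problem \<Rightarrow> bool" where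
  "valid_problem P \<longleftrightarrow>
     (\<forall>t i. y_train P t i \<in> {-1, 1}) \<and> (\<forall>t i. y_val P t i \<in> {-1, 1}) \<and>
     0 \<le> C_lb P \<and> 0 \<le> C_ub P \<and> 0 \<le> w_lb P \<and> 0 \<le> w_ub P"

type_synonym ('k, 'm1, 'm2, 'n) midx =
  "('k \<times> 'm1) + ('k \<times> 'm1) + ('k \<times> 'm2) + ('k \<times> 'm2) + ('k \<times> 'n) + ('k \<times> 'n)"
type_synonym 'n gidx = "unit + unit + 'n + 'n"
type_synonym ('k, 'm1, 'm2, 'n) vidx = "unit + 'n + ('k, 'm1, 'm2, 'n) midx"
type_synonym ('k, 'm1, 'm2, 'n) lidx =
  "'n gidx + ('k, 'm1, 'm2, 'n) midx + ('k, 'm1, 'm2, 'n) midx + ('k, 'm1, 'm2, 'n) midx"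
type_synonym ('k, 'm1, 'm2, 'n) zidx =
  "('k, 'm1, 'm2, 'n) vidx + ('k, 'm1, 'm2, 'n) lidx + ('k, 'm1, 'm2, 'n) midx"
type_synonym ('k, 'm1, 'm2, 'n) Fidx =
  "('k, 'm1, 'm2, 'n) vidx + ('k, 'm1, 'm2, 'n) midx + ('k, 'm1, 'm2, 'n) lidx"

definition matB :: "('k::finite, 'm1::finite, 'm2::finite, 'n::finite) cv_problem \<Rightarrow> real ^ ('k \<times> 'n) ^ ('k \<times> 'm2)" where
  "matB P = block_diag (\<lambda>t. \<chi> i. y_train P t i *\<^sub>R x_train P t i)"

definition matA :: "('k::finite, 'm1::finite, 'm2::finite, 'n::finite) cv_problem \<Rightarrow> real ^ ('k \<times> 'n) ^ ('k \<times> 'm1)" where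
  "matA P = block_diag (\<lambda>t. \<chi> i. y_val P t i *\<^sub>R x_val P t i)"

definition v_C :: "real ^ ('k::finite, 'm1::finite, 'm2::finite, 'n::finite) vidx \<Rightarrow> real" where
  "v_C v = v $ Inl ()"
definition v_w :: "real ^ ('k::finite, 'm1::finite, 'm2::finite, 'n::finite) vidx \<Rightarrow> real ^ 'n" where
  "v_w v = fstblock (sndblock v)"
definition v_zeta :: "real ^ ('k::finite, 'm1::finite, 'm2::finite, 'n::finite) vidx \<Rightarrow> real ^ ('k \<times> 'm1)" where
  "v_zeta v = fstblock (sndblock (sndblock v))"
definition v_z :: "real ^ ('k::finite, 'm1::finite, 'm2::finite, 'n::finite) vidx \<Rightarrow> real ^ ('k \<times> 'm1)" where
  "v_z v = fstblock (sndblock (sndblock (sndblock v)))"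
definition v_alpha :: "real ^ ('k::finite, 'm1::finite, 'm2::finite, 'n::finite) vidx \<Rightarrow> real ^ ('k \<times> 'm2)" where
  "v_alpha v = fstblock (sndblock (sndblock (sndblock (sndblock v))))"
definition v_xi :: "real ^ ('k::finite, 'm1::finite, 'm2::finite, 'n::finite) vidx \<Rightarrow> real ^ ('k \<times> 'm2)" where
  "v_xi v = fstblock (sndblock (sndblock (sndblock (sndblock (sndblock v)))))"
definition v_beta :: "real ^ ('k::finite, 'm1::finite, 'm2::finite, 'n::finite) vidx \<Rightarrow> real ^ ('k \<times> 'n)" where
  "v_beta v = fstblock (sndblock (sndblock (sndblock (sndblock (sndblock (sndblock v))))))"
definition v_gamma :: "real ^ ('k::finite, 'm1::finite, 'm2::finite, 'n::finite) vidx \<Rightarrow> real ^ ('k \<times> 'n)" where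
  "v_gamma v = sndblock (sndblock (sndblock (sndblock (sndblock (sndblock (sndblock v))))))"

definition obj :: "real ^ ('k::finite, 'm1::finite, 'm2::finite, 'n::finite) vidx \<Rightarrow> real" where
  "obj v = 1 / (real CARD('k) * real CARD('m1)) * (\<Sum>i\<in>UNIV. v_zeta v $ i)"

definition con_g ::
    "('k::finite, 'm1::finite, 'm2::finite, 'n::finite) cv_problem \<Rightarrow> real ^ ('k, 'm1, 'm2, 'n) vidx \<Rightarrow> real ^ 'n gidx" where
  "con_g P v =
     vec (C_ub P - v_C v) \<frown> vec (v_C v - C_lb P) \<frown> w_ub P - v_w v \<frown> v_w v - w_lb P"

definition con_H ::
    "real ^ ('k::finite, 'm1::finite, 'm2::finite, 'n::finite) vidx \<Rightarrow> real ^ ('k, 'm1, 'm2, 'n) midx" where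
  "con_H v = v_zeta v \<frown> v_z v \<frown> v_alpha v \<frown> v_xi v \<frown> v_beta v \<frown> v_gamma v"

definition con_G ::
    "('k::finite, 'm1::finite, 'm2::finite, 'n::finite) cv_problem \<Rightarrow> real ^ ('k, 'm1, 'm2, 'n) vidx
      \<Rightarrow> real ^ ('k, 'm1, 'm2, 'n) midx" where
  "con_G P v =
     (let A = matA P; B = matB P;
          \<zeta> = v_zeta v; z = v_z v; \<alpha> = v_alpha v; \<xi> = v_xi v; \<beta> = v_beta v; \<gamma> = v_gamma v;
          Ew = stacked_id *v v_w v
      in (A ** transpose B) *v \<alpha> + A *v \<beta> - A *v \<gamma> + z
         \<frown> 1 - \<zeta>
         \<frown> (B ** transpose B) *v \<alpha> + B *v \<beta> - B *v \<gamma> - 1 + \<xi>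
         \<frown> vec (v_C v) - \<alpha>
         \<frown> transpose B *v \<alpha> + \<beta> - \<gamma> + Ew
         \<frown> - (transpose B *v \<alpha>) - \<beta> + \<gamma> + Ew)"

definition lam_g :: "real ^ ('k::finite, 'm1::finite, 'm2::finite, 'n::finite) lidx \<Rightarrow> real ^ 'n gidx" where
  "lam_g l = fstblock l"
definition lam_G :: "real ^ ('k::finite, 'm1::finite, 'm2::finite, 'n::finite) lidx \<Rightarrow> real ^ ('k, 'm1, 'm2, 'n) midx" where
  "lam_G l = fstblock (sndblock l)"
definition lam_H :: "real ^ ('k::finite, 'm1::finite, 'm2::finite, 'n::finite) lidx \<Rightarrow> real ^ ('k, 'm1, 'm2, 'n) midx" where
  "lam_H l = fstblock (sndblock (sndblock l))"
definition lam_GH :: "real ^ ('k::finite, 'm1::finite, 'm2::finite, 'n::finite) lidx \<Rightarrow> real ^ ('k, 'm1, 'm2, 'n) midx" where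
  "lam_GH l = sndblock (sndblock (sndblock l))"

definition z_v :: "real ^ ('k::finite, 'm1::finite, 'm2::finite, 'n::finite) zidx \<Rightarrow> real ^ ('k, 'm1, 'm2, 'n) vidx" where
  "z_v x = fstblock x"
definition z_lam :: "real ^ ('k::finite, 'm1::finite, 'm2::finite, 'n::finite) zidx \<Rightarrow> real ^ ('k, 'm1, 'm2, 'n) lidx" where
  "z_lam x = fstblock (sndblock x)"
definition z_u :: "real ^ ('k::finite, 'm1::finite, 'm2::finite, 'n::finite) zidx \<Rightarrow> real ^ ('k, 'm1, 'm2, 'n) midx" where
  "z_u x = sndblock (sndblock x)"

definition lagrangian ::
    "('k::finite, 'm1::finite, 'm2::finite, 'n::finite) cv_problem \<Rightarrow> real \<Rightarrow> real ^ ('k, 'm1, 'm2, 'n) vidx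
      \<Rightarrow> real ^ ('k, 'm1, 'm2, 'n) lidx \<Rightarrow> real" where
  "lagrangian P \<tau> v l =
     obj v
     - (\<Sum>i\<in>UNIV. lam_g l $ i * con_g P v $ i)
     - (\<Sum>i\<in>UNIV. lam_G l $ i * con_G P v $ i)
     - (\<Sum>i\<in>UNIV. lam_H l $ i * con_H v $ i)
     + (\<Sum>i\<in>UNIV. lam_GH l $ i * (con_G P v $ i * con_H v $ i - \<tau>))"

definition grad_L ::
    "('k::finite, 'm1::finite, 'm2::finite, 'n::finite) cv_problem \<Rightarrow> real \<Rightarrow> real ^ ('k, 'm1, 'm2, 'n) vidx
      \<Rightarrow> real ^ ('k, 'm1, 'm2, 'n) lidx \<Rightarrow> real ^ ('k, 'm1, 'm2, 'n) vidx" where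
  "grad_L P \<tau> v l = gradient (\<lambda>v. lagrangian P \<tau> v l) v"

definition hess_L ::
    "('k::finite, 'm1::finite, 'm2::finite, 'n::finite) cv_problem \<Rightarrow> real \<Rightarrow> real ^ ('k, 'm1, 'm2, 'n) vidx
      \<Rightarrow> real ^ ('k, 'm1, 'm2, 'n) lidx
      \<Rightarrow> real ^ ('k, 'm1, 'm2, 'n) vidx ^ ('k, 'm1, 'm2, 'n) vidx" where
  "hess_L P \<tau> v l = jacobian (\<lambda>v. grad_L P \<tau> v l) (at v)"

text \<open>The product \<open>*\<close> of two vectors is componentwise.\<close>

definition F_map ::
    "('k::finite, 'm1::finite, 'm2::finite, 'n::finite) cv_problem \<Rightarrow> real \<Rightarrow> real ^ ('k, 'm1, 'm2, 'n) zidx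
      \<Rightarrow> real ^ ('k, 'm1, 'm2, 'n) Fidx" where
  "F_map P \<tau> x =
     (let v = z_v x; l = z_lam x; u = z_u x
      in grad_L P \<tau> v l
         \<frown> u + con_G P v * con_H v - vec \<tau>
         \<frown> vmin (lam_g l) (con_g P v)
         \<frown> vmin (lam_G l) (con_G P v)
         \<frown> vmin (lam_H l) (con_H v)
         \<frown> vmin (lam_GH l) u)"

definition Omega ::
    "('k::finite, 'm1::finite, 'm2::finite, 'n::finite) cv_problem \<Rightarrow> (real ^ ('k, 'm1, 'm2, 'n) zidx) set" where
  "Omega P =
     {x. 0 \<le> z_lam x \<and> 0 \<le> z_u x \<and>
         0 \<le> con_g P (z_v x) \<and> 0 \<le> con_G P (z_v x) \<and> 0 \<le> con_H (z_v x)}"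

text \<open>
  A selection function is given by the sets of indices at which the minimum is replaced by
  its second argument.
\<close>

definition vselect :: "'i set \<Rightarrow> real ^ 'i \<Rightarrow> real ^ 'i \<Rightarrow> real ^ 'i" where
  "vselect S a b = (\<chi> i. if i \<in> S then b $ i else a $ i)"

definition F_sel ::
    "('k::finite, 'm1::finite, 'm2::finite, 'n::finite) cv_problem \<Rightarrow> real
      \<Rightarrow> 'n gidx set \<Rightarrow> ('k, 'm1, 'm2, 'n) midx set
      \<Rightarrow> ('k, 'm1, 'm2, 'n) midx set \<Rightarrow> ('k, 'm1, 'm2, 'n) midx set
      \<Rightarrow> real ^ ('k, 'm1, 'm2, 'n) zidx \<Rightarrow> real ^ ('k, 'm1, 'm2, 'n) Fidx" where
  "F_sel P \<tau> Sg SG SH SGH x =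
     (let v = z_v x; l = z_lam x; u = z_u x
      in grad_L P \<tau> v l
         \<frown> u + con_G P v * con_H v - vec \<tau>
         \<frown> vselect Sg (lam_g l) (con_g P v)
         \<frown> vselect SG (lam_G l) (con_G P v)
         \<frown> vselect SH (lam_H l) (con_H v)
         \<frown> vselect SGH (lam_GH l) u)"

definition admissible_jacobian ::
    "('k::finite, 'm1::finite, 'm2::finite, 'n::finite) cv_problem \<Rightarrow> real \<Rightarrow> real ^ ('k, 'm1, 'm2, 'n) zidx
      \<Rightarrow> real ^ ('k, 'm1, 'm2, 'n) zidx ^ ('k, 'm1, 'm2, 'n) Fidx \<Rightarrow> bool" where
  "admissible_jacobian P \<tau> x J \<longleftrightarrow>
     J \<in> clarke_jacobian (F_map P \<tau>) x \<and>
     (\<exists>Sg SG SH SGH. F_sel P \<tau> Sg SG SH SGH x = F_map P \<tau> x \<and>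
        J = jacobian (F_sel P \<tau> Sg SG SH SGH) (at x))"

text \<open>
  Here \<open>a\<close> stands for \<open>F(x)\<close>, \<open>J\<close> for the chosen generalized Jacobian at \<open>x\<close>, and
  \<^term>\<open>infnorm\<close> is the maximum norm.
\<close>

definition lp_feasible ::
    "(real ^ 'i) set \<Rightarrow> real ^ 'f \<Rightarrow> real ^ 'i ^ 'f \<Rightarrow> real ^ 'i \<Rightarrow> real \<Rightarrow> real ^ 'i \<Rightarrow> bool" where
  "lp_feasible W a J x \<eta> d \<longleftrightarrow>
     infnorm (a + J *v d) \<le> \<eta> * (infnorm a)\<^sup>2 \<and>
     infnorm d \<le> \<eta> * infnorm a \<and>
     x + d \<in> W"

definition lp_solution ::
    "(real ^ 'i) set \<Rightarrow> real ^ 'f \<Rightarrow> real ^ 'i ^ 'f \<Rightarrow> real ^ 'i \<Rightarrow> real \<Rightarrow> real ^ 'i \<Rightarrow> bool" where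
  "lp_solution W a J x \<eta> d \<longleftrightarrow>
     lp_feasible W a J x \<eta> d \<and> (\<forall>\<eta>' d'. lp_feasible W a J x \<eta>' d' \<longrightarrow> \<eta> \<le> \<eta>')"

definition armijo ::
    "(real ^ 'i \<Rightarrow> real ^ 'f) \<Rightarrow> real \<Rightarrow> real \<Rightarrow> real ^ 'i \<Rightarrow> real ^ 'i \<Rightarrow> real \<Rightarrow> nat \<Rightarrow> bool" where
  "armijo F \<sigma>1 \<theta> x d \<Delta> m \<longleftrightarrow>
     infnorm (F (x + \<theta> ^ m *\<^sub>R d)) \<le> infnorm (F x) + \<sigma>1 * \<theta> ^ m * \<Delta>"

text \<open>One iteration from \<open>x\<close> to \<open>x'\<close> in which neither stopping test is met.\<close>

definition inner_step ::
    "('k::finite, 'm1::finite, 'm2::finite, 'n::finite) cv_problem \<Rightarrow> real \<Rightarrow> real \<Rightarrow> real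
      \<Rightarrow> real ^ ('k, 'm1, 'm2, 'n) zidx \<Rightarrow> real ^ ('k, 'm1, 'm2, 'n) zidx \<Rightarrow> bool" where
  "inner_step P \<tau> \<sigma>1 \<theta> x x' \<longleftrightarrow>
     x \<in> Omega P \<and> infnorm (F_map P \<tau> x) \<noteq> 0 \<and>
     (\<exists>J \<eta> d \<Delta> m.
        admissible_jacobian P \<tau> x J \<and>
        lp_solution (Omega P) (F_map P \<tau> x) J x \<eta> d \<and>
        \<Delta> = - infnorm (F_map P \<tau> x) * (1 - \<eta> * infnorm (F_map P \<tau> x)) \<and>
        \<Delta> \<noteq> 0 \<and>
        armijo (F_map P \<tau>) \<sigma>1 \<theta> x d \<Delta> m \<and>
        (\<forall>m' < m. \<not> armijo (F_map P \<tau>) \<sigma>1 \<theta> x d \<Delta> m') \<and>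
        x' = x + \<theta> ^ m *\<^sub>R d)"

definition inner_sequence ::
    "('k::finite, 'm1::finite, 'm2::finite, 'n::finite) cv_problem \<Rightarrow> real \<Rightarrow> real \<Rightarrow> real
      \<Rightarrow> (nat \<Rightarrow> real ^ ('k, 'm1, 'm2, 'n) zidx) \<Rightarrow> bool" where
  "inner_sequence P \<tau> \<sigma>1 \<theta> X \<longleftrightarrow> (\<forall>j. inner_step P \<tau> \<sigma>1 \<theta> (X j) (X (Suc j)))"

definition idx_less :: "real ^ 'i \<Rightarrow> real ^ 'i \<Rightarrow> 'i set" where
  "idx_less a b = {i. a $ i < b $ i}"
definition idx_greater :: "real ^ 'i \<Rightarrow> real ^ 'i \<Rightarrow> 'i set" where
  "idx_greater a b = {i. a $ i > b $ i}"
definition idx_equal :: "real ^ 'i \<Rightarrow> real ^ 'i \<Rightarrow> 'i set" where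
  "idx_equal a b = {i. a $ i = b $ i}"

definition splits :: "'i set \<Rightarrow> 'i set \<Rightarrow> 'i set \<Rightarrow> bool" where
  "splits A A1 A2 \<longleftrightarrow> A = A1 \<union> A2 \<and> A1 \<inter> A2 = {}"

definition S_matrix ::
    "('k::finite, 'm1::finite, 'm2::finite, 'n::finite) cv_problem \<Rightarrow> real ^ ('k, 'm1, 'm2, 'n) vidx
      \<Rightarrow> real ^ ('k, 'm1, 'm2, 'n) midx ^ ('k, 'm1, 'm2, 'n) vidx" where
  "S_matrix P v =
     (\<chi> a i. con_G P v $ i * grad_columns con_H v $ a $ i
           + con_H v $ i * grad_columns (con_G P) v $ a $ i)"

text \<open>
  The matrix of the rank condition before any rows or columns are deleted: its row blocks belong
  to \<open>v\<close>, the complementarity constraints, \<open>g\<close>, \<open>G\<close>, \<open>H\<close>, and its column blocks to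
  \<open>v\<close>, \<open>g\<close>, \<open>G\<close>, \<open>H\<close>, the multipliers for \<open>GH\<close>, and \<open>u\<close>.
\<close>

definition R_matrix ::
    "('k::finite, 'm1::finite, 'm2::finite, 'n::finite) cv_problem \<Rightarrow> real
      \<Rightarrow> real ^ ('k, 'm1, 'm2, 'n) vidx \<Rightarrow> real ^ ('k, 'm1, 'm2, 'n) lidx
      \<Rightarrow> real ^ (('k, 'm1, 'm2, 'n) vidx + 'n gidx + ('k, 'm1, 'm2, 'n) midx
                  + ('k, 'm1, 'm2, 'n) midx + ('k, 'm1, 'm2, 'n) midx + ('k, 'm1, 'm2, 'n) midx)
             ^ (('k, 'm1, 'm2, 'n) vidx + ('k, 'm1, 'm2, 'n) midx + 'n gidx
                  + ('k, 'm1, 'm2, 'n) midx + ('k, 'm1, 'm2, 'n) midx)" where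
  "R_matrix P \<tau> v l =
     (let S = S_matrix P v; Dg = grad_columns (con_g P) v;
          DG = grad_columns (con_G P) v; DH = grad_columns con_H v
      in hess_L P \<tau> v l ||| - Dg ||| - DG ||| - DH ||| S ||| 0
         \<frown> transpose S ||| 0 ||| 0 ||| 0 ||| 0 ||| mat 1
         \<frown> transpose Dg ||| 0 ||| 0 ||| 0 ||| 0 ||| 0
         \<frown> transpose DG ||| 0 ||| 0 ||| 0 ||| 0 ||| 0
         \<frown> transpose DH ||| 0 ||| 0 ||| 0 ||| 0 ||| 0)"

definition condition_R ::
    "('k::finite, 'm1::finite, 'm2::finite, 'n::finite) cv_problem \<Rightarrow> real \<Rightarrow> real ^ ('k, 'm1, 'm2, 'n) zidx \<Rightarrow> bool" where
  "condition_R P \<tau> x \<longleftrightarrow>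
     (let v = z_v x; l = z_lam x; u = z_u x in
      \<forall>Ag31 Ag32 AG31 AG32 AH31 AH32 AGH31 AGH32.
        splits (idx_equal (lam_g l) (con_g P v)) Ag31 Ag32 \<and>
        splits (idx_equal (lam_G l) (con_G P v)) AG31 AG32 \<and>
        splits (idx_equal (lam_H l) (con_H v)) AH31 AH32 \<and>
        splits (idx_equal (lam_GH l) u) AGH31 AGH32 \<longrightarrow>
        (let Pg = idx_greater (lam_g l) (con_g P v) \<union> Ag32;
             PG = idx_greater (lam_G l) (con_G P v) \<union> AG32;
             PH = idx_greater (lam_H l) (con_H v) \<union> AH32;
             PGH = idx_greater (lam_GH l) u \<union> AGH32;
             NGH = idx_less (lam_GH l) u \<union> AGH31
         in submatrix_full_row_rank
              (UNIV <+> UNIV <+> Pg <+> PG <+> PH)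
              (UNIV <+> Pg <+> PG <+> PH <+> PGH <+> NGH)
              (R_matrix P \<tau> v l)))"

end

theory Submission
  imports Defs
begin

text \<open>
  The map \<open>F\<^sub>\<tau>\<close> has as many components as unknowns, and the matrix of the rank condition is square:
  each index of the \<open>GH\<close> block contributes exactly one column, to \<open>P\<close> or to \<open>N\<close>. Full row rank
  therefore means that the Jacobian at \<open>z\<^sup>*\<close> of every active selection function is nonsingular
  (\<open>F_sel_deriv_injective\<close>). This makes \<open>z\<^sup>*\<close> a locally unique zero of every active selection
  function, so the limit of the iteration is \<open>z\<^sup>*\<close> itself.

  All constraints are affine in \<open>v\<close>, so a selection function is quadratic, and its Taylor expansion is
  exact with a second-order term that depends neither on the selection nor on the base point
  (\<open>F_sel_expand\<close>). Together with nonsingularity this gives a two-sided bound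
  \<open>c \<parallel>x - z\<^sup>*\<parallel> \<le> \<parallel>F\<^sub>s(x)\<parallel> \<le> L \<parallel>x - z\<^sup>*\<parallel>\<close> near \<open>z\<^sup>*\<close> for each selection
  \<open>s\<close> active at \<open>z\<^sup>*\<close>. Selections active near \<open>z\<^sup>*\<close> are active at \<open>z\<^sup>*\<close>, by continuity.

  At an iterate \<open>x\<close> near \<open>z\<^sup>*\<close> the direction \<open>z\<^sup>* - x\<close> is feasible for the linear program with a value
  of \<open>\<eta>\<close> bounded by a constant \<open>\<gamma>\<close>, so the optimal value is at most \<open>\<gamma>\<close>. Hence the optimal
  direction \<open>d\<close> has length \<open>O(\<parallel>F(x)\<parallel>)\<close> and its linearized residual is \<open>O(\<parallel>F(x)\<parallel>\<^sup>2)\<close>.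
  The residual of the selection used at \<open>x\<close> is then \<open>O(\<parallel>F(x)\<parallel>\<^sup>2)\<close> at \<open>x + d\<close>, and the error bound for
  that same selection yields \<open>\<parallel>x + d - z\<^sup>*\<parallel> = O(\<parallel>x - z\<^sup>*\<parallel>\<^sup>2)\<close>, even if another selection is
  active at \<open>x + d\<close>. The Lipschitz bound for the latter shows that \<open>\<parallel>F(x + d)\<parallel>\<close> is also
  \<open>O(\<parallel>F(x)\<parallel>\<^sup>2)\<close>, so the line search accepts the full step (\<open>lp_newton_local_step\<close>). Iterating the
  quadratic estimate from a small ball gives convergence at a Q-quadratic rate.
\<close>

section \<open>Block vectors and matrices\<close>

lemma vapp_nth [simp]: "(x \<frown> y) $ Inl i = x $ i" "(x \<frown> y) $ Inr j = y $ j"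
  by (simp_all add: vapp_def)

lemma vec_eq_blocks_iff: "x = y \<longleftrightarrow> fstblock x = fstblock y \<and> sndblock x = sndblock y"
  by (simp add: vec_eq_iff fstblock_def sndblock_def split_sum_all)

lemma fstblock_vapp [simp]: "fstblock (x \<frown> y) = x"
  and sndblock_vapp [simp]: "sndblock (x \<frown> y) = y"
  by (simp_all add: fstblock_def sndblock_def)

lemma vapp_eq_iff [simp]: "x \<frown> y = x' \<frown> y' \<longleftrightarrow> x = x' \<and> y = y'"
  by (auto simp: vec_eq_blocks_iff)

lemma vapp_zero: "(0 :: 'a::zero ^ 'm) \<frown> (0 :: 'a ^ 'n) = 0"
  by (simp add: vec_eq_iff split_sum_all)

lemma vapp_add: "(x \<frown> y) + (x' \<frown> y') = (x + x') \<frown> (y + y')"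
  by (simp add: vec_eq_iff split_sum_all)

lemma vapp_diff: "(x \<frown> y) - (x' \<frown> y') = (x - x') \<frown> (y - y')"
  by (simp add: vec_eq_iff split_sum_all)

lemma vapp_zero_outside:
  "(\<forall>j. j \<notin> A <+> B \<longrightarrow> (x \<frown> y) $ j = 0) \<longleftrightarrow> (\<forall>i. i \<notin> A \<longrightarrow> x $ i = 0) \<and> (\<forall>i. i \<notin> B \<longrightarrow> y $ i = 0)"
  by (auto simp: split_sum_all Plus_def)

lemma vapp_zero_on:
  "(\<forall>j\<in>A <+> B. (x \<frown> y) $ j = 0) \<longleftrightarrow> (\<forall>i\<in>A. x $ i = 0) \<and> (\<forall>i\<in>B. y $ i = 0)"
  by (auto simp: Plus_def ball_Un)

lemma linear_vapp:
  assumes "linear f" "linear g"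
  shows "linear (\<lambda>x. f x \<frown> g x)"
  using assms by (simp add: linear_iff vec_eq_iff split_sum_all)

lemma linear_fstblock: "linear f \<Longrightarrow> linear (\<lambda>x. fstblock (f x))"
  and linear_sndblock: "linear f \<Longrightarrow> linear (\<lambda>x. sndblock (f x))"
  by (simp_all add: linear_iff vec_eq_iff fstblock_def sndblock_def)

lemma linear_compose2: "linear f \<Longrightarrow> linear g \<Longrightarrow> linear (\<lambda>x. f (g x))"
  using linear_compose[of g f] by (simp add: o_def)

lemma linear_matrix_vector_mult:
  fixes M :: "real ^ 'n ^ 'm"
  shows "linear f \<Longrightarrow> linear (\<lambda>x. M *v f x)"
  using linear_compose[of f "(*v) M"] by (simp add: o_def)

lemma linear_matrix_fun_mult_vector:
  fixes M :: "'a::real_vector \<Rightarrow> real ^ 'n ^ 'm"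
  shows "linear M \<Longrightarrow> linear (\<lambda>x. M x *v y)"
  by (simp add: linear_iff matrix_vector_mult_add_rdistrib scaleR_matrix_vector_assoc)

lemma linear_times_vec:
  fixes f :: "'a::real_vector \<Rightarrow> real ^ 'n"
  assumes "linear f"
  shows "linear (\<lambda>x. f x * c)" "linear (\<lambda>x. c * f x)"
  using assms by (simp_all add: linear_iff vec_eq_iff algebra_simps)

lemma linear_vselect: "linear f \<Longrightarrow> linear g \<Longrightarrow> linear (\<lambda>x. vselect S (f x) (g x))"
  by (simp add: linear_iff vec_eq_iff vselect_def)

lemma continuous_on_vapp:
  fixes f :: "'a::topological_space \<Rightarrow> real ^ 'm" and g :: "'a \<Rightarrow> real ^ 'n"
  assumes "continuous_on A f" "continuous_on A g"
  shows "continuous_on A (\<lambda>x. f x \<frown> g x)"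
  unfolding vapp_def
proof (rule continuous_on_vec_lambda)
  fix i :: "'m + 'n"
  show "continuous_on A (\<lambda>x. case i of Inl a \<Rightarrow> f x $ a | Inr b \<Rightarrow> g x $ b)"
    using assms by (cases i) (auto intro!: continuous_intros)
qed

lemma continuous_on_vmin:
  fixes f g :: "'a::topological_space \<Rightarrow> real ^ 'n"
  assumes "continuous_on A f" "continuous_on A g"
  shows "continuous_on A (\<lambda>x. vmin (f x) (g x))"
  unfolding vmin_def using assms
  by (intro continuous_on_vec_lambda continuous_on_min continuous_intros)

lemma vapp_mult_vector:
  fixes M :: "real ^ 'c ^ 'm" and N :: "real ^ 'c ^ 'n"
  shows "(M \<frown> N) *v x = M *v x \<frown> N *v x"
  by (simp add: vec_eq_iff split_sum_all matrix_vector_mult_def)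

lemma matrix_mult_sum_scaleR:
  fixes M :: "real ^ 'n ^ 'm"
  shows "M *v x = (\<Sum>i\<in>UNIV. x $ i *\<^sub>R column i M)"
  by (simp add: matrix_mult_sum scalar_mult_eq_scaleR)

lemma sum_UNIV_Plus:
  "(\<Sum>j\<in>UNIV. f j) = (\<Sum>a\<in>UNIV. f (Inl a)) + (\<Sum>b\<in>UNIV. f (Inr b))"
  for f :: "'a::finite + 'b::finite \<Rightarrow> 'c::comm_monoid_add"
  by (simp add: sum.Plus flip: UNIV_Plus_UNIV)

lemma happ_mult_vector:
  fixes M :: "real ^ 'm ^ 'r" and N :: "real ^ 'n ^ 'r"
  shows "(M ||| N) *v (x \<frown> y) = M *v x + N *v y"
  by (simp add: vec_eq_iff matrix_vector_mult_def happ_def sum_UNIV_Plus)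

lemma matrix_uminus_mult_vector:
  fixes M :: "real ^ 'n ^ 'm"
  shows "(- M) *v x = - (M *v x)"
  by (simp add: vec_eq_iff matrix_vector_mult_def sum_negf)

section \<open>Full row rank and injectivity\<close>

text \<open>
  If some \<open>x \<noteq> 0\<close> supported on \<open>C\<close> were annihilated by the rows in \<open>R\<close>, one column in \<open>C\<close> would
  be a combination of the others. The column space would then be spanned by \<open>card C - 1\<close> vectors,
  less than the rank \<open>card R = card C\<close>.
\<close>

lemma full_row_rank_square_injective:
  fixes M :: "real ^ 'c::finite ^ 'r::finite"
  assumes rank: "submatrix_full_row_rank R C M"
    and square: "card R = card C"
    and supp: "\<And>j. j \<notin> C \<Longrightarrow> x $ j = 0"
    and zero: "\<And>i. i \<in> R \<Longrightarrow> (M *v x) $ i = 0"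
  shows "x = 0"
proof (rule ccontr)
  assume "x \<noteq> 0"
  then obtain k where k: "x $ k \<noteq> 0" by (auto simp: vec_eq_iff)
  with supp have "k \<in> C" by auto
  define T where "T = (\<chi> i j. if i \<in> R \<and> j \<in> C then M $ i $ j else 0)"
  have Tx: "T *v x = 0"
  proof -
    have "(T *v x) $ i = (if i \<in> R then (M *v x) $ i else 0)" for i
      using supp by (auto simp: T_def matrix_vector_mult_def intro!: sum.cong)
    then show ?thesis using zero by (simp add: vec_eq_iff)
  qed
  have col: "column j T = 0" if "j \<notin> C" for j
    using that by (simp add: T_def column_def vec_eq_iff)
  have "T *v y \<in> span ((\<lambda>j. column j T) ` (C - {k}))" for y
  proof -
    \<comment> \<open>Subtracting a multiple of the kernel vector eliminates coordinate \<open>k\<close>.\<close>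
    define w where "w = y - (y $ k / x $ k) *\<^sub>R x"
    have "w $ k = 0" using k by (simp add: w_def)
    have "T *v y = T *v w"
      using Tx by (simp add: w_def matrix_vector_mult_diff_distrib matrix_vector_mult_scaleR)
    also have "\<dots> = (\<Sum>j\<in>UNIV. w $ j *s column j T)"
      by (rule matrix_mult_sum)
    also have "\<dots> = (\<Sum>j\<in>C - {k}. w $ j *s column j T)"
      using col \<open>w $ k = 0\<close> by (intro sum.mono_neutral_right) auto
    also have "\<dots> \<in> span ((\<lambda>j. column j T) ` (C - {k}))"
      unfolding scalar_mult_eq_scaleR by (intro span_sum span_scale span_base imageI)
    finally show ?thesis .
  qed
  then have "range ((*v) T) \<subseteq> span ((\<lambda>j. column j T) ` (C - {k}))" by auto
  then have "dim (range ((*v) T)) \<le> card ((\<lambda>j. column j T) ` (C - {k}))"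
    by (rule dim_le_card) simp
  also have "\<dots> \<le> card (C - {k})" by (rule card_image_le) simp
  also have "\<dots> < card C" using \<open>k \<in> C\<close> by (intro psubset_card_mono) auto
  also have "card C = rank T"
    using rank square by (simp add: submatrix_full_row_rank_def submatrix_rank_def T_def)
  finally show False by (simp add: rank_dim_range)
qed

section \<open>Affine maps\<close>

definition affine_map :: "('a::real_vector \<Rightarrow> 'b::real_vector) \<Rightarrow> bool" where
  "affine_map f \<longleftrightarrow> linear (\<lambda>x. f x - f 0)"

lemma affine_map_linear: "linear f \<Longrightarrow> affine_map f"
  by (simp add: affine_map_def linear_0)

lemma affine_map_const: "affine_map (\<lambda>x. c)"
  by (simp add: affine_map_def linear_zero)

lemma affine_map_add: "affine_map f \<Longrightarrow> affine_map g \<Longrightarrow> affine_map (\<lambda>x. f x + g x)"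
  unfolding affine_map_def linear_iff by (simp add: algebra_simps)

lemma affine_map_diff: "affine_map f \<Longrightarrow> affine_map g \<Longrightarrow> affine_map (\<lambda>x. f x - g x)"
  unfolding affine_map_def linear_iff by (simp add: algebra_simps)

lemma affine_map_vapp:
  fixes f :: "'a::real_vector \<Rightarrow> real ^ 'm" and g :: "'a \<Rightarrow> real ^ 'n"
  assumes "affine_map f" "affine_map g"
  shows "affine_map (\<lambda>x. f x \<frown> g x)"
  using assms unfolding affine_map_def vapp_diff by (rule linear_vapp)

lemma affine_map_compose_linear: "affine_map f \<Longrightarrow> linear k \<Longrightarrow> affine_map (\<lambda>x. k (f x))"
  unfolding affine_map_def
  using linear_compose[of "\<lambda>x. f x - f 0" k] by (simp add: o_def linear_diff)

lemma affine_map_uminus: "affine_map f \<Longrightarrow> affine_map (\<lambda>x. - f x)"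
  using affine_map_diff[OF affine_map_const[of 0]] by simp

lemma affine_map_matrix:
  fixes M :: "real ^ 'n ^ 'm"
  shows "affine_map f \<Longrightarrow> affine_map (\<lambda>x. M *v f x)"
  by (rule affine_map_compose_linear) auto

lemma jacobian_mult_vector:
  fixes f :: "real ^ 'a \<Rightarrow> real ^ 'b"
  assumes "(f has_derivative D) (at x)"
  shows "jacobian f (at x) *v h = D h"
  using assms has_derivative_unique jacobian_works differentiable_def by metis

lemma affine_map_has_derivative:
  fixes f :: "'a::euclidean_space \<Rightarrow> 'b::real_normed_vector"
  assumes "affine_map f"
  shows "(f has_derivative (\<lambda>h. f h - f 0)) (at x)"
proof -
  have "((\<lambda>y. (f y - f 0) + f 0) has_derivative (\<lambda>h. f h - f 0)) (at x)"
    using assms unfolding affine_map_def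
    by (intro has_derivative_add_const linear_imp_has_derivative)
  then show ?thesis by simp
qed

lemma affine_map_grad_columns:
  fixes f :: "real ^ 'a \<Rightarrow> real ^ 'b"
  assumes "affine_map f"
  shows "transpose (grad_columns f w) *v h = f h - f 0"
  using jacobian_mult_vector[OF affine_map_has_derivative[OF assms]]
  by (simp add: grad_columns_def)

text \<open>
  The gradient matrix of an affine map is constant, so it may be evaluated at any point \<open>w\<close>.
\<close>

lemma affine_map_expand:
  fixes f :: "real ^ 'a \<Rightarrow> real ^ 'b"
  assumes "affine_map f"
  shows "f (v + h) = f v + transpose (grad_columns f w) *v h"
proof -
  have "f (v + h) - f 0 = (f v - f 0) + (f h - f 0)"
    using assms linear_add unfolding affine_map_def by fastforce
  then show ?thesis
    unfolding affine_map_grad_columns[OF assms] by (simp add: algebra_simps)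
qed

lemma affine_map_grad_columns_const:
  fixes f :: "real ^ 'a \<Rightarrow> real ^ 'b"
  assumes "affine_map f"
  shows "grad_columns f v = grad_columns f w"
proof -
  have "transpose (grad_columns f v) = transpose (grad_columns f w)"
    using affine_map_grad_columns[OF assms] by (simp add: matrix_eq)
  then show ?thesis by (metis transpose_transpose)
qed

lemma continuous_on_affine_map:
  fixes f :: "'a::euclidean_space \<Rightarrow> 'b::real_normed_vector"
  assumes "affine_map f" "continuous_on A g"
  shows "continuous_on A (\<lambda>x. f (g x))"
proof (rule continuous_on_compose2[OF _ assms(2)])
  show "continuous_on UNIV f"
    using affine_map_has_derivative[OF assms(1)] has_derivative_continuous
    by (intro continuous_at_imp_continuous_on) blast
qed simp

section \<open>Constraint maps\<close>

lemma linear_v_C: "linear v_C" by (simp add: linear_iff v_C_def)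

lemma linear_v_w: "linear v_w"
  and linear_v_zeta: "linear v_zeta"
  and linear_v_z: "linear v_z"
  and linear_v_alpha: "linear v_alpha"
  and linear_v_xi: "linear v_xi"
  and linear_v_beta: "linear v_beta"
  and linear_v_gamma: "linear v_gamma"
  unfolding v_w_def[abs_def] v_zeta_def[abs_def] v_z_def[abs_def] v_alpha_def[abs_def]
    v_xi_def[abs_def] v_beta_def[abs_def] v_gamma_def[abs_def]
  by (intro linear_fstblock linear_sndblock linear_ident)+

lemmas linear_v_parts = linear_v_C linear_v_w linear_v_zeta linear_v_z linear_v_alpha
  linear_v_xi linear_v_beta linear_v_gamma

lemma affine_map_con_g: "affine_map (con_g P)"
  unfolding con_g_def[abs_def]
  by (intro affine_map_vapp affine_map_diff affine_map_const
      affine_map_compose_linear[OF _ linear_vec] affine_map_linear[OF linear_v_C]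
      affine_map_linear[OF linear_v_w])

lemma linear_con_H: "linear con_H"
  unfolding con_H_def[abs_def] by (intro linear_vapp linear_v_parts)

lemma affine_map_con_H: "affine_map con_H"
  by (rule affine_map_linear[OF linear_con_H])

lemma affine_map_con_G: "affine_map (con_G P)"
  unfolding con_G_def[abs_def] Let_def
  by (intro affine_map_vapp affine_map_diff affine_map_add affine_map_uminus affine_map_const
      affine_map_matrix affine_map_compose_linear[OF _ linear_vec] linear_v_parts[THEN affine_map_linear])

section \<open>Lagrangian\<close>

lemma gradient_eqI: "GDERIV f x :> D \<Longrightarrow> gradient f x = D"
  unfolding gradient_def
proof (rule the_equality)
  fix E assume "GDERIV f x :> D" "GDERIV f x :> E"
  then have "(\<lambda>h. h \<bullet> E) = (\<lambda>h. h \<bullet> D)"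
    unfolding gderiv_def by (rule has_derivative_unique[rotated])
  then show "E = D" by (metis inner_commute vector_eq_rdot)
qed

lemma GDERIV_sum:
  assumes "\<And>i. i \<in> I \<Longrightarrow> GDERIV (f i) x :> D i"
  shows "GDERIV (\<lambda>y. \<Sum>i\<in>I. f i y) x :> (\<Sum>i\<in>I. D i)"
  using assms unfolding gderiv_def inner_sum_right by (rule has_derivative_sum)

lemma GDERIV_cmult: "GDERIV f x :> D \<Longrightarrow> GDERIV (\<lambda>y. c * f y) x :> c *\<^sub>R D"
  for c :: real
  unfolding gderiv_def inner_scaleR_right by (rule has_derivative_mult_right)

lemma GDERIV_linear:
  fixes f :: "'a::euclidean_space \<Rightarrow> real"
  assumes "linear f"
  shows "GDERIV f x :> (\<Sum>b\<in>Basis. f b *\<^sub>R b)"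
proof -
  have "f h = h \<bullet> (\<Sum>b\<in>Basis. f b *\<^sub>R b)" for h
  proof -
    have "f h = f (\<Sum>b\<in>Basis. (h \<bullet> b) *\<^sub>R b)" by (simp add: euclidean_representation)
    also have "\<dots> = (\<Sum>b\<in>Basis. (h \<bullet> b) * f b)"
      by (simp add: linear_sum[OF assms] linear_scale[OF assms])
    finally show ?thesis by (simp add: inner_sum_right mult.commute)
  qed
  then have "(\<lambda>h. h \<bullet> (\<Sum>b\<in>Basis. f b *\<^sub>R b)) = f" by (intro ext) (rule sym)
  then show ?thesis
    unfolding gderiv_def using linear_imp_has_derivative[OF assms] by (simp only:)
qed

lemma GDERIV_affine_component:
  fixes f :: "real ^ 'a \<Rightarrow> real ^ 'b"
  assumes "affine_map f"
  shows "GDERIV (\<lambda>v. f v $ i) v :> column i (grad_columns f v)"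
proof -
  have "((\<lambda>v. f v $ i) has_derivative (\<lambda>h. (f h - f 0) $ i)) (at v)"
    by (rule bounded_linear.has_derivative[OF bounded_linear_vec_nth affine_map_has_derivative[OF assms]])
  then show ?thesis
    unfolding gderiv_def affine_map_grad_columns[OF assms, of v, symmetric]
      matrix_vector_mul_component
    by (simp add: transpose_def column_def inner_commute)
qed

lemma linear_obj: "linear obj"
  unfolding obj_def[abs_def]
  by (auto simp: linear_iff linear_v_zeta[THEN linear_add] linear_v_zeta[THEN linear_scale]
      sum.distrib distrib_left add_divide_distrib simp flip: sum_distrib_left)

definition obj_gradient :: "real ^ ('k::finite, 'm1::finite, 'm2::finite, 'n::finite) vidx" where
  "obj_gradient = (\<Sum>b\<in>Basis. obj b *\<^sub>R b)"

lemma column_S_matrix: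
  "column i (S_matrix P v) =
     con_G P v $ i *\<^sub>R column i (grad_columns con_H v) + con_H v $ i *\<^sub>R column i (grad_columns (con_G P) v)"
  by (simp add: S_matrix_def column_def vec_eq_iff)

text \<open>
  The gradient is evaluated in closed form so that its dependence on \<open>(v, \<lambda>)\<close> becomes visible: it is
  affine in \<open>\<lambda>\<close> for fixed \<open>v\<close>, and \<open>v\<close> enters only through \<open>S\<close>.
\<close>

lemma grad_L_eq:
  "grad_L P \<tau> v l =
     obj_gradient - grad_columns (con_g P) v *v lam_g l - grad_columns (con_G P) v *v lam_G l
       - grad_columns con_H v *v lam_H l + S_matrix P v *v lam_GH l"
proof -
  have "GDERIV (\<lambda>v. con_G P v $ i * con_H v $ i - \<tau>) v :> column i (S_matrix P v) - 0" for i
    unfolding column_S_matrix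
    by (intro GDERIV_diff GDERIV_const GDERIV_mult GDERIV_affine_component affine_map_con_G affine_map_con_H)
  then show ?thesis
    unfolding grad_L_def lagrangian_def matrix_mult_sum_scaleR obj_gradient_def
    by (intro gradient_eqI GDERIV_add GDERIV_diff GDERIV_linear linear_obj GDERIV_sum GDERIV_cmult
        GDERIV_affine_component affine_map_con_g affine_map_con_G affine_map_con_H) simp
qed

text \<open>
  Since \<open>G\<close> and \<open>H\<close> are affine with constant gradients, the matrix \<open>S\<close> is affine in \<open>v\<close>; this is its
  linear part.
\<close>

definition S_variation ::
    "('k::finite, 'm1::finite, 'm2::finite, 'n::finite) cv_problem \<Rightarrow> real ^ ('k, 'm1, 'm2, 'n) vidx
      \<Rightarrow> real ^ ('k, 'm1, 'm2, 'n) midx ^ ('k, 'm1, 'm2, 'n) vidx" where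
  "S_variation P h = S_matrix P h - S_matrix P 0"

lemma S_matrix_nth:
  "S_matrix P v $ a $ i = con_G P v $ i * grad_columns con_H 0 $ a $ i + con_H v $ i * grad_columns (con_G P) 0 $ a $ i"
  by (simp add: S_matrix_def affine_map_grad_columns_const[OF affine_map_con_H, of v 0]
      affine_map_grad_columns_const[OF affine_map_con_G, of P v 0])

lemma linear_S_variation: "linear (S_variation P)"
proof -
  have G: "con_G P (x + y) = con_G P x + con_G P y - con_G P 0"
    "con_G P (c *\<^sub>R x) = c *\<^sub>R con_G P x - c *\<^sub>R con_G P 0 + con_G P 0" for x y c
    using affine_map_con_G[of P] unfolding affine_map_def linear_iff by (simp_all add: algebra_simps)
  show ?thesis
    by (auto simp: linear_iff S_variation_def vec_eq_iff S_matrix_nth G linear_add[OF linear_con_H]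
        linear_scale[OF linear_con_H] linear_0[OF linear_con_H] algebra_simps)
qed

lemma S_matrix_add: "S_matrix P (v + h) = S_matrix P v + S_variation P h"
  using linear_add[OF linear_S_variation, of P v h] by (simp add: S_variation_def algebra_simps)

lemma grad_L_add_v: "grad_L P \<tau> (v + h) l = grad_L P \<tau> v l + S_variation P h *v lam_GH l"
  unfolding grad_L_eq S_matrix_add
  by (simp add: affine_map_grad_columns_const[OF affine_map_con_H, of "v + h" v]
      affine_map_grad_columns_const[OF affine_map_con_g, of P "v + h" v]
      affine_map_grad_columns_const[OF affine_map_con_G, of P "v + h" v]
      matrix_vector_mult_add_rdistrib)

text \<open>
  Only the complementarity products are nonlinear in \<open>v\<close>, so the Hessian sees no multiplier but
  \<open>\<lambda>\<^bsup>GH\<^esup>\<close>.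
\<close>

lemma hess_L_mult_vector: "hess_L P \<tau> v l *v h = S_variation P h *v lam_GH l"
proof -
  have var: "grad_L P \<tau> h l - grad_L P \<tau> 0 l = S_variation P h *v lam_GH l" for h
    using grad_L_add_v[of P \<tau> 0 h l] by simp
  then have "affine_map (\<lambda>v. grad_L P \<tau> v l)"
    using linear_matrix_fun_mult_vector[OF linear_S_variation, of P "lam_GH l"]
    by (simp add: affine_map_def)
  from affine_map_grad_columns[OF this, of v h] var show ?thesis
    by (simp add: hess_L_def grad_columns_def)
qed

section \<open>Selection functions\<close>

lemma linear_z_v: "linear z_v" and linear_z_lam: "linear z_lam" and linear_z_u: "linear z_u"
  and linear_lam_g: "linear lam_g" and linear_lam_G: "linear lam_G" and linear_lam_H: "linear lam_H"
  and linear_lam_GH: "linear lam_GH"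
  unfolding z_v_def[abs_def] z_lam_def[abs_def] z_u_def[abs_def]
    lam_g_def[abs_def] lam_G_def[abs_def] lam_H_def[abs_def] lam_GH_def[abs_def]
  by (intro linear_fstblock linear_sndblock linear_ident)+

lemmas linear_z_parts = linear_z_v linear_z_lam linear_z_u
lemmas linear_lam_parts = linear_lam_g linear_lam_G linear_lam_H linear_lam_GH

definition F_sel_deriv ::
    "('k::finite, 'm1::finite, 'm2::finite, 'n::finite) cv_problem \<Rightarrow> real
      \<Rightarrow> 'n gidx set \<Rightarrow> ('k, 'm1, 'm2, 'n) midx set
      \<Rightarrow> ('k, 'm1, 'm2, 'n) midx set \<Rightarrow> ('k, 'm1, 'm2, 'n) midx set
      \<Rightarrow> real ^ ('k, 'm1, 'm2, 'n) zidx \<Rightarrow> real ^ ('k, 'm1, 'm2, 'n) zidx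
      \<Rightarrow> real ^ ('k, 'm1, 'm2, 'n) Fidx" where
  "F_sel_deriv P \<tau> Sg SG SH SGH x d =
     (let v = z_v x; S = S_matrix P v; Dg = grad_columns (con_g P) v;
          DG = grad_columns (con_G P) v; DH = grad_columns con_H v;
          dv = z_v d; dl = z_lam d; du = z_u d
      in hess_L P \<tau> v (z_lam x) *v dv - Dg *v lam_g dl - DG *v lam_G dl - DH *v lam_H dl + S *v lam_GH dl
         \<frown> du + transpose S *v dv
         \<frown> vselect Sg (lam_g dl) (transpose Dg *v dv)
         \<frown> vselect SG (lam_G dl) (transpose DG *v dv)
         \<frown> vselect SH (lam_H dl) (transpose DH *v dv)
         \<frown> vselect SGH (lam_GH dl) du)"

text \<open>
  The second-order term of every selection function: the blocks that come from the minima are affine and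
  contribute nothing.
\<close>

definition F_quad ::
    "('k::finite, 'm1::finite, 'm2::finite, 'n::finite) cv_problem
      \<Rightarrow> real ^ ('k, 'm1, 'm2, 'n) zidx \<Rightarrow> real ^ ('k, 'm1, 'm2, 'n) zidx
      \<Rightarrow> real ^ ('k, 'm1, 'm2, 'n) Fidx" where
  "F_quad P d e =
     S_variation P (z_v d) *v lam_GH (z_lam e)
       \<frown> (transpose (grad_columns (con_G P) 0) *v z_v d) * (transpose (grad_columns con_H 0) *v z_v e)
       \<frown> 0 \<frown> 0 \<frown> 0 \<frown> 0"

lemma linear_F_sel_deriv: "linear (F_sel_deriv P \<tau> Sg SG SH SGH x)"
  unfolding F_sel_deriv_def[abs_def] Let_def
  by (intro linear_vapp linear_vselect linear_compose_add linear_compose_sub linear_matrix_vector_mult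
      linear_z_parts linear_lam_parts[THEN linear_compose2])

lemma bilinear_F_quad: "bilinear (F_quad P)"
  unfolding bilinear_def F_quad_def
  by (intro conjI allI linear_vapp linear_zero linear_times_vec linear_matrix_vector_mult linear_z_parts
      linear_lam_parts[THEN linear_compose2] linear_matrix_fun_mult_vector linear_S_variation[THEN linear_compose2])

lemma transpose_S_matrix_mult_vector:
  "transpose (S_matrix P v) *v h =
     con_G P v * (transpose (grad_columns con_H v) *v h) + con_H v * (transpose (grad_columns (con_G P) v) *v h)"
  by (simp add: vec_eq_iff matrix_vector_mult_def transpose_def S_matrix_def sum.distrib sum_distrib_left
      algebra_simps del: transpose_matrix_vector)

lemma vselect_add: "vselect S (a + a') (b + b') = vselect S a b + vselect S a' b'"
  by (simp add: vselect_def vec_eq_iff)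

text \<open>
  The expansion stops at second order because each component of a selection function is a polynomial of
  degree at most two in \<open>(v, \<lambda>, u)\<close>.
\<close>

lemma F_sel_expand:
  "F_sel P \<tau> Sg SG SH SGH (x + d) =
     F_sel P \<tau> Sg SG SH SGH x + F_sel_deriv P \<tau> Sg SG SH SGH x d + F_quad P d d"
proof -
  let ?v = "z_v x" and ?l = "z_lam x" and ?dv = "z_v d" and ?dl = "z_lam d"
  note parts = linear_z_parts[THEN linear_add] linear_lam_parts[THEN linear_add]
  have grad: "grad_L P \<tau> (?v + ?dv) (?l + ?dl) =
      grad_L P \<tau> ?v ?l + (hess_L P \<tau> ?v ?l *v ?dv - grad_columns (con_g P) ?v *v lam_g ?dl
        - grad_columns (con_G P) ?v *v lam_G ?dl - grad_columns con_H ?v *v lam_H ?dl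
        + S_matrix P ?v *v lam_GH ?dl) + S_variation P ?dv *v lam_GH ?dl"
    unfolding grad_L_add_v hess_L_mult_vector
    unfolding grad_L_eq parts by (simp add: matrix_vector_right_distrib)
  have prod: "con_G P (?v + ?dv) * con_H (?v + ?dv) =
      con_G P ?v * con_H ?v + transpose (S_matrix P ?v) *v ?dv +
      (transpose (grad_columns (con_G P) 0) *v ?dv) * (transpose (grad_columns con_H 0) *v ?dv)"
    unfolding affine_map_expand[OF affine_map_con_G, of P ?v _ 0]
      affine_map_expand[OF affine_map_con_H, of ?v _ 0] transpose_S_matrix_mult_vector
      affine_map_grad_columns_const[OF affine_map_con_H, of ?v 0]
      affine_map_grad_columns_const[OF affine_map_con_G, of P ?v 0]
    by (simp add: algebra_simps del: transpose_matrix_vector)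
  show ?thesis
    unfolding F_sel_def F_sel_deriv_def F_quad_def Let_def parts grad prod
    unfolding affine_map_expand[OF affine_map_con_G, of P ?v ?dv ?v] affine_map_expand[OF affine_map_con_H, of ?v ?dv ?v]
      affine_map_expand[OF affine_map_con_g, of P ?v ?dv ?v] vselect_add vapp_add
    by (simp add: algebra_simps del: transpose_matrix_vector)
qed

lemma F_sel_remainder_bound:
  obtains K where "K > 0"
    "\<And>Sg SG SH SGH x d. norm (F_sel P \<tau> Sg SG SH SGH (x + d) - F_sel P \<tau> Sg SG SH SGH x
        - F_sel_deriv P \<tau> Sg SG SH SGH x d) \<le> K * (norm d)\<^sup>2"
proof -
  obtain K where K: "K > 0" "\<And>d e. norm (F_quad P d e) \<le> K * norm d * norm e"
    using bilinear_bounded_pos[OF bilinear_F_quad] by blast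
  show thesis
    by (rule that[OF K(1)]) (use K(2) in \<open>simp add: F_sel_expand power2_eq_square mult.assoc\<close>)
qed

lemma has_derivative_quadratic_remainder:
  fixes f :: "'a::euclidean_space \<Rightarrow> 'b::real_normed_vector"
  assumes "linear D" and rem: "\<And>h. norm (f (x + h) - f x - D h) \<le> K * (norm h)\<^sup>2"
  shows "(f has_derivative D) (at x)"
  unfolding has_derivative_at
proof
  show "bounded_linear D" using assms(1) by (rule linear_conv_bounded_linear[THEN iffD1])
  have "((\<lambda>h::'a. K * norm h) \<longlongrightarrow> K * norm (0::'a)) (at 0)" by (intro tendsto_intros)
  then have lim: "((\<lambda>h::'a. K * norm h) \<longlongrightarrow> 0) (at 0)" by simp
  show "(\<lambda>h. norm (f (x + h) - f x - D h) / norm h) \<midarrow>0\<rightarrow> 0"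
  proof (rule tendsto_sandwich[OF _ _ tendsto_const lim])
    show "\<forall>\<^sub>F h in at 0. norm (f (x + h) - f x - D h) / norm h \<le> K * norm h"
      using rem by (auto simp: eventually_at divide_simps power2_eq_square mult.assoc intro!: exI[of _ 1])
  qed simp
qed

lemma F_sel_has_derivative:
  "(F_sel P \<tau> Sg SG SH SGH has_derivative F_sel_deriv P \<tau> Sg SG SH SGH x) (at x)"
  by (rule F_sel_remainder_bound[of P \<tau>])
    (rule has_derivative_quadratic_remainder[OF linear_F_sel_deriv])

lemma jacobian_F_sel: "jacobian (F_sel P \<tau> Sg SG SH SGH) (at x) *v d = F_sel_deriv P \<tau> Sg SG SH SGH x d"
  by (rule jacobian_mult_vector[OF F_sel_has_derivative])

lemma continuous_on_F_map: "continuous_on UNIV (F_map P \<tau>)"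
proof -
  note linear_cont = affine_map_linear[THEN continuous_on_affine_map]
  have sel: "continuous_on UNIV (F_sel P \<tau> {} {} {} {})"
    using F_sel_has_derivative has_derivative_continuous
    by (intro continuous_at_imp_continuous_on) blast
  have "continuous_on UNIV (\<lambda>x. fstblock (F_sel P \<tau> {} {} {} {} x))"
    by (rule linear_cont[OF linear_fstblock[OF linear_ident] sel])
  then have grad: "continuous_on UNIV (\<lambda>x. grad_L P \<tau> (z_v x) (z_lam x))"
    by (simp add: F_sel_def Let_def)
  have "continuous_on UNIV (\<lambda>x. fstblock (sndblock (F_sel P \<tau> {} {} {} {} x)))"
    by (rule linear_cont[OF linear_fstblock[OF linear_sndblock[OF linear_ident]] sel])
  then have prod: "continuous_on UNIV (\<lambda>x. z_u x + con_G P (z_v x) * con_H (z_v x) - vec \<tau>)"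
    by (simp add: F_sel_def Let_def)
  show ?thesis
    unfolding F_map_def[abs_def] Let_def
    by (intro continuous_on_vapp continuous_on_vmin grad prod linear_z_parts[THEN linear_cont]
        linear_lam_parts[THEN linear_cont] affine_map_con_g[THEN continuous_on_affine_map]
        affine_map_con_G[THEN continuous_on_affine_map] affine_map_con_H[THEN continuous_on_affine_map]
        continuous_on_id)
qed

section \<open>Regularity of the active selections\<close>

lemma vselect_greater: "vselect {i. b $ i < a $ i} a b = vmin a b"
  by (simp add: vselect_def vmin_def vec_eq_iff)

lemma ex_active_selection: "\<exists>Sg SG SH SGH. F_sel P \<tau> Sg SG SH SGH x = F_map P \<tau> x"
  unfolding F_sel_def F_map_def Let_def
  by (simp, intro conjI exI) (rule vselect_greater)+

text \<open>
  A selection that agrees with the minimum may choose freely only where both arguments coincide. Thus an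
  active selection arises from an admissible partition, whose index set \<open>P\<close>
  is the selected set.
\<close>

lemma vselect_eq_vmin_split:
  assumes "vselect S a b = vmin a b"
  shows "idx_greater a b \<union> (idx_equal a b \<inter> S) = S"
    and "idx_less a b \<union> (idx_equal a b - S) = - S"
proof -
  have "i \<in> S \<longleftrightarrow> a $ i > b $ i \<or> (a $ i = b $ i \<and> i \<in> S)" for i
    using assms by (auto simp: vselect_def vmin_def vec_eq_iff min_def split: if_splits dest!: spec[of _ i])
  moreover have "i \<notin> S \<longleftrightarrow> a $ i < b $ i \<or> (a $ i = b $ i \<and> i \<notin> S)" for i
    using assms by (auto simp: vselect_def vmin_def vec_eq_iff min_def split: if_splits dest!: spec[of _ i])
  ultimately show "idx_greater a b \<union> (idx_equal a b \<inter> S) = S"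
    and "idx_less a b \<union> (idx_equal a b - S) = - S"
    by (auto simp: idx_greater_def idx_less_def idx_equal_def)
qed

lemma splits_Int_Diff: "splits A (A - S) (A \<inter> S)"
  by (auto simp: splits_def)

lemma condition_R_active_selection:
  assumes R: "condition_R P \<tau> z" and active: "F_sel P \<tau> Sg SG SH SGH z = F_map P \<tau> z"
  shows "submatrix_full_row_rank (UNIV <+> UNIV <+> Sg <+> SG <+> SH)
           (UNIV <+> Sg <+> SG <+> SH <+> SGH <+> - SGH) (R_matrix P \<tau> (z_v z) (z_lam z))"
proof -
  let ?v = "z_v z" and ?l = "z_lam z" and ?u = "z_u z"
  have sel: "vselect Sg (lam_g ?l) (con_g P ?v) = vmin (lam_g ?l) (con_g P ?v)"
    "vselect SG (lam_G ?l) (con_G P ?v) = vmin (lam_G ?l) (con_G P ?v)"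
    "vselect SH (lam_H ?l) (con_H ?v) = vmin (lam_H ?l) (con_H ?v)"
    "vselect SGH (lam_GH ?l) ?u = vmin (lam_GH ?l) ?u"
    using active by (simp_all add: F_sel_def F_map_def Let_def)
  show ?thesis
    using R[unfolded condition_R_def Let_def, rule_format,
        OF conjI[OF splits_Int_Diff[of _ Sg] conjI[OF splits_Int_Diff[of _ SG]
          conjI[OF splits_Int_Diff[of _ SH] splits_Int_Diff[of _ SGH]]]]]
    unfolding sel[THEN vselect_eq_vmin_split(1)] sel(4)[THEN vselect_eq_vmin_split(2)] .
qed

text \<open>
  Applied to the increments \<open>(dv, d\<lambda>, du)\<close>, the rows of the undeleted matrix are the linearizations of
  the Lagrangian gradient, of the complementarity equations, and of \<open>g\<close>, \<open>G\<close> and \<open>H\<close>, the same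
  expressions that make up the derivative of a selection function.
\<close>

lemma R_matrix_mult_vector:
  "R_matrix P \<tau> v l *v (dv \<frown> a \<frown> b \<frown> c \<frown> e \<frown> du) =
     hess_L P \<tau> v l *v dv - grad_columns (con_g P) v *v a - grad_columns (con_G P) v *v b
         - grad_columns con_H v *v c + S_matrix P v *v e
     \<frown> du + transpose (S_matrix P v) *v dv
     \<frown> transpose (grad_columns (con_g P) v) *v dv
     \<frown> transpose (grad_columns (con_G P) v) *v dv
     \<frown> transpose (grad_columns con_H v) *v dv"
  unfolding R_matrix_def Let_def vapp_mult_vector happ_mult_vector matrix_uminus_mult_vector
  by (simp add: algebra_simps del: transpose_matrix_vector)

lemma vselect_eq_zero:
  fixes a b :: "real ^ 'i"
  assumes "vselect S a b = 0"
  shows "i \<notin> S \<Longrightarrow> a $ i = 0" and "i \<in> S \<Longrightarrow> b $ i = 0"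
  using assms by (auto simp: vselect_def vec_eq_iff split: if_splits dest: spec[of _ i])

text \<open>
  In the kernel of the derivative, the rows that select a multiplier force the increments of the
  multipliers outside the selected sets to vanish, and likewise \<open>du\<close> on \<open>SGH\<close>. What remains is
  annihilated by the matrix of the rank condition, which is square because \<open>SGH\<close> and its complement
  together have as many elements as the block of complementarity rows.
\<close>

lemma F_sel_deriv_injective:
  fixes P :: "('k::finite, 'm1::finite, 'm2::finite, 'n::finite) cv_problem"
  assumes R: "condition_R P \<tau> z" and active: "F_sel P \<tau> Sg SG SH SGH z = F_map P \<tau> z"
    and zero: "F_sel_deriv P \<tau> Sg SG SH SGH z d = 0"
  shows "d = 0"
proof -
  let ?v = "z_v z" and ?l = "z_lam z"
  let ?dv = "z_v d" and ?dl = "z_lam d" and ?du = "z_u d"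
  let ?R = "(UNIV :: ('k, 'm1, 'm2, 'n) vidx set) <+> (UNIV :: ('k, 'm1, 'm2, 'n) midx set) <+> Sg <+> SG <+> SH"
  let ?C = "(UNIV :: ('k, 'm1, 'm2, 'n) vidx set) <+> Sg <+> SG <+> SH <+> SGH <+> - SGH"
  define y where "y = ?dv \<frown> lam_g ?dl \<frown> lam_G ?dl \<frown> lam_H ?dl \<frown> lam_GH ?dl \<frown> ?du"
  have blocks: "hess_L P \<tau> ?v ?l *v ?dv - grad_columns (con_g P) ?v *v lam_g ?dl
        - grad_columns (con_G P) ?v *v lam_G ?dl - grad_columns con_H ?v *v lam_H ?dl
        + S_matrix P ?v *v lam_GH ?dl = 0"
    "?du + transpose (S_matrix P ?v) *v ?dv = 0"
    and sel: "vselect Sg (lam_g ?dl) (transpose (grad_columns (con_g P) ?v) *v ?dv) = 0"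
    "vselect SG (lam_G ?dl) (transpose (grad_columns (con_G P) ?v) *v ?dv) = 0"
    "vselect SH (lam_H ?dl) (transpose (grad_columns con_H ?v) *v ?dv) = 0"
    "vselect SGH (lam_GH ?dl) ?du = 0"
    using zero unfolding F_sel_deriv_def Let_def vapp_zero[symmetric] vapp_eq_iff by blast+
  have "y = 0"
  proof (rule full_row_rank_square_injective[OF condition_R_active_selection[OF R active]])
    have "card SGH + card (- SGH) = card (UNIV :: ('k, 'm1, 'm2, 'n) midx set)"
      by (subst card_Un_disjoint[symmetric]) (auto simp: Compl_partition)
    then show "card ?R = card ?C"
      by (simp add: card_Plus)
    have "\<forall>j. j \<notin> ?C \<longrightarrow> y $ j = 0"
      unfolding y_def vapp_zero_outside
      using sel[THEN vselect_eq_zero(1)] sel(4)[THEN vselect_eq_zero(2)] by blast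
    then show "y $ j = 0" if "j \<notin> ?C" for j using that by blast
    have "\<forall>i\<in>?R. (R_matrix P \<tau> ?v ?l *v y) $ i = 0"
      unfolding y_def R_matrix_mult_vector blocks vapp_zero_on zero_index
      using sel[THEN vselect_eq_zero(2)] by blast
    then show "(R_matrix P \<tau> ?v ?l *v y) $ i = 0" if "i \<in> ?R" for i using that by blast
  qed
  then have "?dv = 0" "lam_g ?dl = 0" "lam_G ?dl = 0" "lam_H ?dl = 0" "lam_GH ?dl = 0" "?du = 0"
    by (simp_all add: y_def flip: vapp_zero)
  then show ?thesis
    unfolding z_v_def z_lam_def z_u_def lam_g_def lam_G_def lam_H_def lam_GH_def
    by (simp add: vec_eq_iff fstblock_def sndblock_def split_sum_all)
qed


section \<open>The local LP-Newton step\<close>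

lemma uniform_injectivity_bound:
  fixes A :: "'s::finite \<Rightarrow> real ^ 'i ^ 'f" and active :: "'s \<Rightarrow> bool"
  assumes "\<And>s (h::real ^ 'i). active s \<Longrightarrow> A s *v h = 0 \<Longrightarrow> h = 0"
  shows "\<exists>c>0. \<forall>s h. active s \<longrightarrow> c * norm h \<le> norm (A s *v h)"
proof -
  have "\<exists>c>0. active s \<longrightarrow> (\<forall>h. c * norm h \<le> norm (A s *v h))" for s
  proof (cases "active s")
    case True
    then have "inj ((*v) (A s))"
      using assms by (simp add: linear_injective_0)
    then show ?thesis
      by (metis linear_inj_bounded_below_pos matrix_vector_mul_linear)
  qed (auto intro: exI[of _ 1])
  then obtain c where c: "\<And>s. c s > 0" "\<And>s (h::real ^ 'i). active s \<Longrightarrow> c s * norm h \<le> norm (A s *v h)"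
    by metis
  show ?thesis
  proof (intro exI[of _ "Min (range c)"] conjI allI impI)
    show "Min (range c) > 0" using c(1) by simp
    fix s and h :: "real ^ 'i" assume "active s"
    have "Min (range c) * norm h \<le> c s * norm h" by (intro mult_right_mono) auto
    also have "\<dots> \<le> norm (A s *v h)" using c(2) \<open>active s\<close> .
    finally show "Min (range c) * norm h \<le> norm (A s *v h)" .
  qed
qed

lemma uniform_operator_bound:
  fixes A :: "'s::finite \<Rightarrow> real ^ 'i ^ 'f"
  shows "\<exists>L>0. \<forall>s h. norm (A s *v h) \<le> L * norm h"
proof -
  have "\<exists>L>0. \<forall>h. norm (A s *v h) \<le> L * norm h" for s
    using linear_bounded_pos[of "(*v) (A s)"] by auto
  then obtain L where L: "\<And>s. L s > 0" "\<And>s (h::real ^ 'i). norm (A s *v h) \<le> L s * norm h" by metis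
  show ?thesis
  proof (intro exI[of _ "Max (range L)"] conjI allI)
    show "Max (range L) > 0" using L(1) by (simp add: Max_gr_iff)
    fix s and h :: "real ^ 'i"
    have "norm (A s *v h) \<le> L s * norm h" by (rule L)
    also have "\<dots> \<le> Max (range L) * norm h" by (intro mult_right_mono) auto
    finally show "norm (A s *v h) \<le> Max (range L) * norm h" .
  qed
qed

text \<open>
  Two continuous functions that differ at \<open>z\<close> differ near \<open>z\<close>; finiteness of the set of pieces makes the
  neighbourhood uniform.
\<close>

lemma active_pieces_near:
  fixes F :: "'a::metric_space \<Rightarrow> 'b::t2_space" and Fs :: "'s::finite \<Rightarrow> 'a \<Rightarrow> 'b"
  assumes "isCont F z" "\<And>s. isCont (Fs s) z"
  shows "\<exists>\<epsilon>>0. \<forall>s x. dist x z < \<epsilon> \<longrightarrow> Fs s x = F x \<longrightarrow> Fs s z = F z"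
proof -
  have "\<forall>\<^sub>F x in nhds z. Fs s z \<noteq> F z \<longrightarrow> Fs s x \<noteq> F x" for s
  proof (cases "Fs s z = F z")
    case False
    then obtain U V where UV: "open U" "open V" "Fs s z \<in> U" "F z \<in> V" "U \<inter> V = {}"
      using hausdorff[OF False] by blast
    have "(Fs s \<longlongrightarrow> Fs s z) (nhds z)" "(F \<longlongrightarrow> F z) (nhds z)"
      using assms by (simp_all add: isCont_def tendsto_at_iff_tendsto_nhds)
    then have "\<forall>\<^sub>F x in nhds z. Fs s x \<in> U" "\<forall>\<^sub>F x in nhds z. F x \<in> V"
      using UV by (simp_all add: topological_tendstoD)
    then show ?thesis by eventually_elim (use UV in auto)
  qed simp
  then have "\<forall>\<^sub>F x in nhds z. \<forall>s. Fs s z \<noteq> F z \<longrightarrow> Fs s x \<noteq> F x"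
    by (simp add: eventually_all_finite)
  then show ?thesis
    unfolding eventually_nhds_metric by blast
qed

text \<open>
  The direction \<open>z - x\<close> is feasible with a bounded value of \<open>\<eta>\<close>, so minimality of \<open>\<eta>\<close> controls \<open>d\<close>
  and its linearized residual. The piece used at \<open>x\<close> then has a residual of second order at \<open>x + d\<close>, and
  its nonsingular derivative turns this into a distance to \<open>z\<close> of second order. Whichever piece is active at
  \<open>x + d\<close> is Lipschitz and vanishes at \<open>z\<close>, so the full step already passes the line search test.
\<close>

lemma lp_newton_local_step:
  fixes F :: "real ^ 'i \<Rightarrow> real ^ 'f" and Fs :: "'s::finite \<Rightarrow> real ^ 'i \<Rightarrow> real ^ 'f"
    and J :: "'s \<Rightarrow> real ^ 'i \<Rightarrow> real ^ 'i ^ 'f" and z :: "real ^ 'i" and W :: "(real ^ 'i) set"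
  assumes cont: "isCont F z" "\<And>s. isCont (Fs s) z"
    and cover: "\<And>x. \<exists>s. Fs s x = F x"
    and K: "K > 0" "\<And>s x h. norm (Fs s (x + h) - Fs s x - J s x *v h) \<le> K * (norm h)\<^sup>2"
    and inj: "\<And>s h. Fs s z = F z \<Longrightarrow> J s z *v h = 0 \<Longrightarrow> h = 0"
    and root: "F z = 0" "z \<in> W"
    and \<sigma>: "0 < \<sigma>" "\<sigma> < 1"
  shows "\<exists>r>0. \<exists>C>0. \<forall>x s \<eta> d.
     norm (x - z) \<le> r \<longrightarrow> F x \<noteq> 0 \<longrightarrow> Fs s x = F x \<longrightarrow> lp_solution W (F x) (J s x) x \<eta> d \<longrightarrow>
       armijo F \<sigma> \<theta> x d (- infnorm (F x) * (1 - \<eta> * infnorm (F x))) 0 \<and>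
       norm (x + d - z) \<le> C * (norm (x - z))\<^sup>2"
proof -
  obtain \<epsilon>1 where \<epsilon>1: "\<epsilon>1 > 0" "\<And>s x. dist x z < \<epsilon>1 \<Longrightarrow> Fs s x = F x \<Longrightarrow> Fs s z = F z"
    using active_pieces_near[where F = F and Fs = Fs and z = z, OF cont] by blast
  have "\<exists>c>0. \<forall>s h. Fs s z = F z \<longrightarrow> c * norm h \<le> norm (J s z *v h)"
    by (rule uniform_injectivity_bound) (rule inj)
  then obtain c0 where c0: "c0 > 0" "\<And>s h. Fs s z = F z \<Longrightarrow> c0 * norm h \<le> norm (J s z *v h)"
    by blast
  obtain L0 where L0: "L0 > 0" "\<And>s (h::real ^ 'i). norm (J s z *v h) \<le> L0 * norm h"
    using uniform_operator_bound[where A = "\<lambda>s. J s z"] by blast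
  define c where "c = c0 / 2"
  define L where "L = L0 + c"
  define \<epsilon> where "\<epsilon> = min \<epsilon>1 (c / K)"
  have pos: "c > 0" "L > 0" "\<epsilon> > 0"
    using c0(1) L0(1) K(1) \<epsilon>1(1) by (auto simp: c_def L_def \<epsilon>_def add_pos_pos)
  \<comment> \<open>For \<open>norm (x - z) < c / K\<close> the second-order term at \<open>z\<close>
    is absorbed by half of the lower bound \<open>c0\<close>.\<close>
  have bounds: "c * norm (x - z) \<le> norm (Fs s x)" "norm (Fs s x) \<le> L * norm (x - z)"
    if x: "norm (x - z) < \<epsilon>" and s: "Fs s z = F z" for s x
  proof -
    have "K * norm (x - z) \<le> c" using x K(1) by (simp add: \<epsilon>_def field_simps)
    then have rem: "K * (norm (x - z))\<^sup>2 \<le> c * norm (x - z)"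
      by (simp add: power2_eq_square mult_right_mono flip: mult.assoc)
    have near: "norm (Fs s x - J s z *v (x - z)) \<le> c * norm (x - z)"
      using K(2)[of s z "x - z"] s root(1) rem by simp
    have "c0 * norm (x - z) \<le> norm (J s z *v (x - z))" by (rule c0(2)[OF s])
    also have "\<dots> \<le> norm (Fs s x) + norm (Fs s x - J s z *v (x - z))"
      using norm_triangle_sub[of "J s z *v (x - z)" "Fs s x"] by (simp add: norm_minus_commute)
    finally show "c * norm (x - z) \<le> norm (Fs s x)" using near by (simp add: c_def)
    have "norm (Fs s x) \<le> norm (J s z *v (x - z)) + norm (Fs s x - J s z *v (x - z))"
      by (rule norm_triangle_sub)
    then show "norm (Fs s x) \<le> L * norm (x - z)"
      using near L0(2)[of s "x - z"] by (simp add: L_def algebra_simps)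
  qed
  have active: "Fs s z = F z" if "norm (x - z) < \<epsilon>" "Fs s x = F x" for s x
    by (rule \<epsilon>1(2)[where x = x]) (use that in \<open>auto simp: \<epsilon>_def dist_norm\<close>)

  \<comment> \<open>The linear program is stated in the maximum norm;
    \<open>p\<close> and \<open>q\<close> convert to the Euclidean norm.\<close>
  define p where "p = sqrt DIM(real ^ 'f)"
  define q where "q = sqrt DIM(real ^ 'i)"
  have pq: "p > 0" "q > 0" by (simp_all add: p_def q_def)
  have p: "norm y \<le> p * infnorm y" for y :: "real ^ 'f"
    unfolding p_def by (rule norm_le_infnorm)
  have q: "norm y \<le> q * infnorm y" for y :: "real ^ 'i"
    unfolding q_def by (rule norm_le_infnorm)
  \<comment> \<open>\<open>\<gamma>\<close> is a value of \<open>\<eta>\<close> with which the exact direction \<open>z - x\<close> is feasible, and \<open>M\<close> bounds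
    the residual after the step. The two terms of \<open>r\<close>
    keep the new point in the \<open>\<epsilon>\<close>-ball and enforce sufficient decrease.\<close>
  define \<gamma> where "\<gamma> = K * (p / c)\<^sup>2 + p / c"
  define M where "M = K * (q * \<gamma>)\<^sup>2 + p * \<gamma>"
  have "\<gamma> > 0" using pos pq K(1) by (auto simp: \<gamma>_def intro!: add_pos_pos)
  then have pos': "\<gamma> > 0" "M > 0" using pq K(1) by (auto simp: M_def intro!: add_pos_pos)
  define Q where "Q = 1 + q * \<gamma> * L"
  define r where "r = min (\<epsilon> / (2 * Q)) ((1 - \<sigma>) * c / (L * M * L))"
  have "Q > 1" using pos pos' pq by (simp add: Q_def)
  have "r > 0" using pos pos' pq \<sigma> \<open>Q > 1\<close> by (simp add: r_def)
  have "Q * r \<le> Q * (\<epsilon> / (2 * Q))"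
    using \<open>Q > 1\<close> by (intro mult_left_mono) (auto simp: r_def)
  also have "\<dots> = \<epsilon> / 2" using \<open>Q > 1\<close> by (simp add: field_simps)
  finally have r1: "Q * r < \<epsilon>" using pos by simp
  have r2: "L * (M / c) * (L * r) \<le> 1 - \<sigma>"
  proof -
    have "r \<le> (1 - \<sigma>) * c / (L * M * L)" by (simp add: r_def)
    then show ?thesis using pos pos' by (simp add: field_simps)
  qed
  have "M / c * L\<^sup>2 > 0" using pos pos' by simp
  moreover have "armijo F \<sigma> \<theta> x d (- infnorm (F x) * (1 - \<eta> * infnorm (F x))) 0 \<and>
      norm (x + d - z) \<le> M / c * L\<^sup>2 * (norm (x - z))\<^sup>2"
    if xr: "norm (x - z) \<le> r" and Fx: "F x \<noteq> 0" and s: "Fs s x = F x"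
      and sol: "lp_solution W (F x) (J s x) x \<eta> d" for x s \<eta> d
  proof -
    define a where "a = infnorm (F x)"
    define e where "e = norm (x - z)"
    have "a > 0" using Fx by (simp add: a_def infnorm_pos_lt)
    have "e \<ge> 0" "e \<le> r" using xr by (simp_all add: e_def)
    have "e \<le> Q * r"
      using \<open>e \<le> r\<close> \<open>e \<ge> 0\<close> \<open>Q > 1\<close> mult_right_mono[of 1 Q r] \<open>r > 0\<close> by linarith
    then have x\<epsilon>: "norm (x - z) < \<epsilon>" using r1 by (simp add: e_def)
    have sz: "Fs s z = F z" by (rule active[OF x\<epsilon> s])
    have "c * e \<le> norm (F x)" "norm (F x) \<le> L * e"
      using bounds[OF x\<epsilon> sz] by (simp_all add: s e_def)
    then have ea: "e \<le> p / c * a" and ae: "a \<le> L * e"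
      using p[of "F x"] infnorm_le_norm[of "F x"] pos by (simp_all add: a_def field_simps)
    have "lp_feasible W (F x) (J s x) x \<gamma> (z - x)"
      unfolding lp_feasible_def a_def[symmetric]
    proof (intro conjI)
      have "norm (F x + J s x *v (z - x)) \<le> K * e\<^sup>2"
      proof -
        have "Fs s (x + (z - x)) - Fs s x - J s x *v (z - x) = - (F x + J s x *v (z - x))"
          by (simp add: s sz root(1))
        with K(2)[of s x "z - x"] show ?thesis
          by (metis e_def norm_minus_cancel norm_minus_commute)
      qed
      also have "\<dots> \<le> K * (p / c * a)\<^sup>2"
        using ea \<open>e \<ge> 0\<close> K(1) by (intro mult_left_mono power_mono) auto
      also have "\<dots> = K * (p / c)\<^sup>2 * a\<^sup>2" by (simp only: power_mult_distrib mult.assoc)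
      also have "\<dots> \<le> \<gamma> * a\<^sup>2"
        using pos pq by (intro mult_right_mono) (auto simp: \<gamma>_def)
      finally show "infnorm (F x + J s x *v (z - x)) \<le> \<gamma> * a\<^sup>2"
        using infnorm_le_norm order_trans by blast
      have "infnorm (z - x) \<le> e" using infnorm_le_norm[of "z - x"] by (simp add: e_def norm_minus_commute)
      also note ea
      also have "p / c * a \<le> \<gamma> * a"
        using pos pq K(1) \<open>a > 0\<close> by (intro mult_right_mono) (auto simp: \<gamma>_def)
      finally show "infnorm (z - x) \<le> \<gamma> * a" .
      show "x + (z - x) \<in> W" using root(2) by simp
    qed
    with sol have "\<eta> \<le> \<gamma>" unfolding lp_solution_def by blast
    have feas: "infnorm (F x + J s x *v d) \<le> \<eta> * a\<^sup>2" "infnorm d \<le> \<eta> * a"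
      using sol unfolding lp_solution_def lp_feasible_def a_def by auto
    have "0 \<le> \<eta> * a" using feas(2) infnorm_pos_le order_trans by blast
    have d: "norm d \<le> q * \<gamma> * a"
    proof -
      have "norm d \<le> q * (\<eta> * a)"
        using q[of d] feas(2) pq by (meson mult_left_mono order_trans less_imp_le)
      also have "\<dots> \<le> q * (\<gamma> * a)"
        using \<open>\<eta> \<le> \<gamma>\<close> pq \<open>a > 0\<close> by (intro mult_left_mono mult_right_mono) auto
      finally show ?thesis by (simp add: mult.assoc)
    qed
    define w where "w = x + d"
    have "norm (w - z) \<le> e + norm d"
      using norm_triangle_ineq[of "x - z" d] by (simp add: w_def e_def algebra_simps)
    also have "\<dots> \<le> e + q * \<gamma> * (L * e)"
      using d ae pq pos' mult_left_mono[of a "L * e" "q * \<gamma>"] by (simp add: order_trans)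
    also have "\<dots> = Q * e" by (simp add: Q_def algebra_simps)
    also have "\<dots> \<le> Q * r"
      using \<open>e \<le> r\<close> \<open>Q > 1\<close> by (intro mult_left_mono) auto
    finally have w\<epsilon>: "norm (w - z) < \<epsilon>" using r1 by simp
    have lin: "norm (F x + J s x *v d) \<le> p * \<gamma> * a\<^sup>2"
    proof -
      have "norm (F x + J s x *v d) \<le> p * (\<eta> * a\<^sup>2)"
        using p[of "F x + J s x *v d"] feas(1) pq by (meson mult_left_mono order_trans less_imp_le)
      also have "\<dots> \<le> p * (\<gamma> * a\<^sup>2)"
        using \<open>\<eta> \<le> \<gamma>\<close> pq by (intro mult_left_mono mult_right_mono) auto
      finally show ?thesis by (simp add: mult.assoc)
    qed
    have "norm (Fs s w) \<le> norm (Fs s w - Fs s x - J s x *v d) + norm (F x + J s x *v d)"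
      using norm_triangle_ineq[of "Fs s w - Fs s x - J s x *v d" "F x + J s x *v d"] by (simp add: s)
    also have "\<dots> \<le> K * (q * \<gamma> * a)\<^sup>2 + p * \<gamma> * a\<^sup>2"
    proof (rule add_mono[OF order_trans lin])
      show "norm (Fs s w - Fs s x - J s x *v d) \<le> K * (norm d)\<^sup>2" unfolding w_def by (rule K(2))
      show "K * (norm d)\<^sup>2 \<le> K * (q * \<gamma> * a)\<^sup>2"
        using d K(1) by (intro mult_left_mono power_mono) auto
    qed
    also have "\<dots> = M * a\<^sup>2" by (simp add: M_def algebra_simps power_mult_distrib)
    finally have "c * norm (w - z) \<le> M * a\<^sup>2" using bounds(1)[OF w\<epsilon> sz] by linarith
    then have wa: "norm (w - z) \<le> M / c * a\<^sup>2" using pos by (simp add: field_simps)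
    have "norm (w - z) \<le> M / c * (L * e)\<^sup>2"
      using wa ae \<open>a > 0\<close> pos pos' by (meson divide_pos_pos less_imp_le mult_left_mono order_trans power_mono)
    then have quad: "norm (x + d - z) \<le> M / c * L\<^sup>2 * (norm (x - z))\<^sup>2"
      by (simp add: w_def e_def power_mult_distrib algebra_simps)
    \<comment> \<open>The piece active at \<open>w\<close> may differ from \<open>s\<close>, but it is active at \<open>z\<close> as well.\<close>
    obtain t where t: "Fs t w = F w" using cover by blast
    have "infnorm (F w) \<le> norm (Fs t w)" by (simp add: t infnorm_le_norm)
    also have "\<dots> \<le> L * norm (w - z)" using bounds(2)[OF w\<epsilon> active[OF w\<epsilon> t]] .
    also have "\<dots> \<le> L * (M / c * a\<^sup>2)" using wa pos by (intro mult_left_mono) auto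
    also have "\<dots> = L * (M / c) * a * a" by (simp add: power2_eq_square)
    also have "\<dots> \<le> (1 - \<sigma>) * a"
    proof (rule mult_right_mono)
      have "a \<le> L * r" using ae \<open>e \<le> r\<close> pos mult_left_mono[of e r L] by linarith
      then have "L * (M / c) * a \<le> L * (M / c) * (L * r)"
        using pos pos' by (intro mult_left_mono) auto
      with r2 show "L * (M / c) * a \<le> 1 - \<sigma>" by linarith
    qed (use \<open>a > 0\<close> in simp)
    also have "\<dots> \<le> a + \<sigma> * (- a * (1 - \<eta> * a))"
    proof -
      have "0 \<le> \<sigma> * a * (\<eta> * a)" using \<open>0 \<le> \<eta> * a\<close> \<sigma> \<open>a > 0\<close> by simp
      then show ?thesis by (simp add: algebra_simps)
    qed
    finally have "armijo F \<sigma> \<theta> x d (- a * (1 - \<eta> * a)) 0"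
      by (simp add: armijo_def w_def a_def)
    with quad show ?thesis by (simp add: a_def)
  qed
  ultimately show ?thesis using \<open>r > 0\<close> by blast
qed

text \<open>
  With \<open>C \<rho> \<le> 1/2\<close> the quadratic estimate at least halves the distance in each step, so the sequence
  never leaves the ball in which the estimate holds.
\<close>

lemma quadratic_contraction_converges:
  fixes X :: "nat \<Rightarrow> 'a::real_normed_vector"
  assumes step: "\<And>j. norm (X j - z) \<le> r \<Longrightarrow> norm (X (Suc j) - z) \<le> C * (norm (X j - z))\<^sup>2"
    and start: "norm (X 0 - z) \<le> \<rho>" and \<rho>: "\<rho> \<le> r" "C * \<rho> \<le> 1 / 2" and C: "C \<ge> 0"
  shows "X \<longlonglongrightarrow> z" "Q_quadratic_rate X z"
proof -
  have "\<rho> \<ge> 0" using start norm_ge_zero order_trans by blast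
  have bound: "norm (X j - z) \<le> \<rho> * (1 / 2) ^ j" for j
  proof (induction j)
    case (Suc j)
    have "\<rho> * (1 / 2) ^ j \<le> \<rho> * 1"
      using \<open>\<rho> \<ge> 0\<close> by (intro mult_left_mono power_le_one) auto
    with Suc have le: "norm (X j - z) \<le> \<rho>" by simp
    then have "norm (X (Suc j) - z) \<le> C * norm (X j - z) * norm (X j - z)"
      using step[of j] \<rho>(1) by (simp add: power2_eq_square mult.assoc)
    also have "\<dots> \<le> 1 / 2 * (\<rho> * (1 / 2) ^ j)"
      using Suc C \<rho>(2) mult_left_mono[OF le C] by (intro mult_mono) auto
    finally show ?case by simp
  qed (use start in simp)
  have "norm (X j - z) \<le> r" for j
  proof -
    have "\<rho> * (1 / 2) ^ j \<le> \<rho> * 1"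
      using \<open>\<rho> \<ge> 0\<close> by (intro mult_left_mono power_le_one) auto
    with bound[of j] \<rho>(1) show ?thesis by simp
  qed
  then show "Q_quadratic_rate X z"
    using step unfolding Q_quadratic_rate_def by (auto intro: exI[of _ C])
  have "(\<lambda>j. \<rho> * (1 / 2) ^ j) \<longlonglongrightarrow> 0"
    by (intro tendsto_mult_right_zero LIMSEQ_realpow_zero) auto
  then have "(\<lambda>j. X j - z) \<longlonglongrightarrow> 0"
    by (rule Lim_null_comparison[rotated]) (use bound in auto)
  then show "X \<longlonglongrightarrow> z" by (rule LIM_zero_cancel)
qed

section \<open>Local quadratic convergence of the inner loop\<close>

theorem theorem2:
  fixes P :: "('k::finite, 'm1::finite, 'm2::finite, 'n::finite) cv_problem"
    and \<tau> \<sigma>1 \<theta> :: real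
    and zstar :: "real ^ ('k, 'm1, 'm2, 'n) zidx"
    and Z :: "(real ^ ('k, 'm1, 'm2, 'n) zidx) set"
  assumes "valid_problem P"
    and "\<tau> > 0"
    and "0 < \<sigma>1" "\<sigma>1 < 1" "0 < \<theta>" "\<theta> < 1"
    and Z_def: "Z = {x \<in> Omega P. F_map P \<tau> x = 0}"
    and "zstar \<in> Z"
    and "condition_R P \<tau> zstar"
  shows "\<exists>r>0. \<forall>X. inner_sequence P \<tau> \<sigma>1 \<theta> X \<and> X 0 \<in> cball zstar r \<inter> Omega P \<longrightarrow>
           (\<exists>zhat\<in>Z. X \<longlonglongrightarrow> zhat \<and> Q_quadratic_rate X zhat)"
proof -
  define Fs where "Fs = (\<lambda>(Sg, SG, SH, SGH). F_sel P \<tau> Sg SG SH SGH)"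
  define J where "J = (\<lambda>s x. jacobian (Fs s) (at x))"
  obtain K where K: "K > 0"
    "\<And>Sg SG SH SGH x d. norm (F_sel P \<tau> Sg SG SH SGH (x + d) - F_sel P \<tau> Sg SG SH SGH x
        - F_sel_deriv P \<tau> Sg SG SH SGH x d) \<le> K * (norm d)\<^sup>2"
    using F_sel_remainder_bound[of P \<tau>] by metis
  have "\<exists>r>0. \<exists>C>0. \<forall>x s \<eta> d.
     norm (x - zstar) \<le> r \<longrightarrow> F_map P \<tau> x \<noteq> 0 \<longrightarrow> Fs s x = F_map P \<tau> x \<longrightarrow>
       lp_solution (Omega P) (F_map P \<tau> x) (J s x) x \<eta> d \<longrightarrow>
       armijo (F_map P \<tau>) \<sigma>1 \<theta> x d (- infnorm (F_map P \<tau> x) * (1 - \<eta> * infnorm (F_map P \<tau> x))) 0 \<and>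
       norm (x + d - zstar) \<le> C * (norm (x - zstar))\<^sup>2"
  proof (rule lp_newton_local_step[OF _ _ _ K(1)])
    show "isCont (F_map P \<tau>) zstar"
      using continuous_on_F_map[of P \<tau>] by (simp add: continuous_on_eq_continuous_at)
    show "isCont (Fs s) zstar" for s
      by (cases s) (auto simp: Fs_def intro: has_derivative_continuous F_sel_has_derivative)
    show "\<exists>s. Fs s x = F_map P \<tau> x" for x
      using ex_active_selection[of P \<tau> x] by (auto simp: Fs_def)
    show "norm (Fs s (x + h) - Fs s x - J s x *v h) \<le> K * (norm h)\<^sup>2" for s x h
      by (cases s) (simp add: Fs_def J_def jacobian_F_sel K(2))
    show "h = 0" if "Fs s zstar = F_map P \<tau> zstar" "J s zstar *v h = 0" for s h
      using that F_sel_deriv_injective[OF \<open>condition_R P \<tau> zstar\<close>]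
      by (cases s) (simp add: Fs_def J_def jacobian_F_sel)
  qed (use assms in auto)
  then obtain r C where rC: "r > 0" "C > 0" and local_step:
    "\<And>x s \<eta> d. \<lbrakk>norm (x - zstar) \<le> r; F_map P \<tau> x \<noteq> 0; Fs s x = F_map P \<tau> x;
       lp_solution (Omega P) (F_map P \<tau> x) (J s x) x \<eta> d\<rbrakk> \<Longrightarrow>
       armijo (F_map P \<tau>) \<sigma>1 \<theta> x d (- infnorm (F_map P \<tau> x) * (1 - \<eta> * infnorm (F_map P \<tau> x))) 0 \<and>
       norm (x + d - zstar) \<le> C * (norm (x - zstar))\<^sup>2"
    by metis
  have contraction: "norm (x' - zstar) \<le> C * (norm (x - zstar))\<^sup>2"
    if step: "inner_step P \<tau> \<sigma>1 \<theta> x x'" and near: "norm (x - zstar) \<le> r" for x x'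
  proof -
    obtain Sg SG SH SGH \<eta> d m where it:
      "F_map P \<tau> x \<noteq> 0" "F_sel P \<tau> Sg SG SH SGH x = F_map P \<tau> x"
      "lp_solution (Omega P) (F_map P \<tau> x) (jacobian (F_sel P \<tau> Sg SG SH SGH) (at x)) x \<eta> d"
      "\<forall>m'<m. \<not> armijo (F_map P \<tau>) \<sigma>1 \<theta> x d (- infnorm (F_map P \<tau> x) * (1 - \<eta> * infnorm (F_map P \<tau> x))) m'"
      "x' = x + \<theta> ^ m *\<^sub>R d"
      using step unfolding inner_step_def admissible_jacobian_def by (auto simp: infnorm_eq_0)
    have acc: "armijo (F_map P \<tau>) \<sigma>1 \<theta> x d (- infnorm (F_map P \<tau> x) * (1 - \<eta> * infnorm (F_map P \<tau> x))) 0"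
      "norm (x + d - zstar) \<le> C * (norm (x - zstar))\<^sup>2"
      using local_step[OF near it(1), of "(Sg, SG, SH, SGH)" \<eta> d] it(2,3) by (simp_all add: Fs_def J_def)
    with it(4) have "m = 0" by blast
    with acc(2) it(5) show ?thesis by simp
  qed
  define \<rho> where "\<rho> = min r (1 / (2 * C))"
  have \<rho>: "\<rho> > 0" "\<rho> \<le> r" "C * \<rho> \<le> 1 / 2"
    using rC by (auto simp: \<rho>_def min_def field_simps)
  have "X \<longlonglongrightarrow> zstar \<and> Q_quadratic_rate X zstar"
    if "inner_sequence P \<tau> \<sigma>1 \<theta> X" "X 0 \<in> cball zstar \<rho>" for X
  proof -
    have "norm (X (Suc j) - zstar) \<le> C * (norm (X j - zstar))\<^sup>2" if "norm (X j - zstar) \<le> r" for j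
      using contraction that \<open>inner_sequence P \<tau> \<sigma>1 \<theta> X\<close> unfolding inner_sequence_def by blast
    moreover have "norm (X 0 - zstar) \<le> \<rho>"
      using that(2) by (simp add: dist_norm norm_minus_commute)
    ultimately show ?thesis
      using quadratic_contraction_converges[of X zstar r C \<rho>] \<rho> rC(2) by simp
  qed
  then show ?thesis using \<rho>(1) \<open>zstar \<in> Z\<close> by blast
qed

end
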